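(* (a) For any nonempty class $\mathcal A$ of kernels sharing the same matched bulk data, a predictor restricted to those data returns a single number on the whole class, and its best worst-case error for the real output $R$ is exactly $$E(\mathcal A):=\inf_{a\in\mathbb R}\sup_{q\in\mathcal A}|R(q)-a|=\tfrac12\Big(\sup_{\mathcal A}R-\inf_{\mathcal A}R\Big);$$ no differentiability of $R$ is needed. (b) Let $\mathcal A_{M,\varepsilon}=\{q_0(1+h):h\in\mathcal T_M,\ \|h\|_\infty\le\varepsilon\}$ with $0<\varepsilon<1$, suppose $R$ has a $C^2$ continuation in $h$ over $\mathcal A_{M,\varepsilon}$ with $\|D_h^2R\|\le H$, and put $R_0=R(q_0)$, $r_\varepsilon=\tfrac12H\varepsilon^2$. Then $$\Big|\sup_{\mathcal A_{M,\varepsilon}}R-(R_0+\varepsilon D_M)\Big|\le r_\varepsilon,\qquad \Big|\inf_{\mathcal A_{M,\varepsilon}}R-(R_0-\varepsilon D_M)\Big|\le r_\varepsilon,$$ so that $\sup_{\mathcal A_{M,\varepsilon}}R-\inf_{\mathcal A_{M,\varepsilon}}R=2\varepsilon D_M+O(\varepsilon^2)$. Consequently every predictor $\widehat R$ that reads only $\gamma_1,\dots,\gamma_M$ obeys $$\inf_{\widehat R}\ \sup_{q\in\mathcal A_{M,\varepsilon}}|R(q)-\widehat R|=\varepsilon D_M+O(\varepsilon^2),$$ and the optimum is attained by predicting the midpoint of the interval $[\inf_{\mathcal A_{M,\varepsilon}}R,\ \sup_{\mathcal A_{M,\varepsilon}}R]$.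
   Context: $q_0$ is a bounded, strictly positive, even probability density on the circle (the base turning kernel); $C=(1,\cos\varphi,\dots,\cos M\varphi)$; $\mathcal T_M$ is the space of bounded even $u$ with $\int q_0uC\,d\varphi=0$. For a kernel $q$ and fixed $\alpha>0$, the rates are $\gamma_m(q)=\alpha(1-\int q\cos m\varphi\,d\varphi)$; all members of $\mathcal A_{M,\varepsilon}$ share $\gamma_1,\dots,\gamma_M$. $R(q)$ is a real output of the kernel: in the paper, the growth rate $\mathrm{Re}\,\lambda(q)$ of a simple isolated interfacial eigenvalue continued along the same branch. Its derivative at $q_0$ is represented as $DR[q_0h]=\int q_0h\Psi\,d\varphi$, $h\in\mathcal T_M$, with $\Psi$ bounded, continuous and even, and $D_M=\inf_{a\in\mathbb R^{M+1}}\int q_0|\Psi-a\cdot C|\,d\varphi$. The bound $\|D_h^2R\|\le H$ is for the second derivative as a bilinear form with respect to $\|\cdot\|_\infty$, uniformly over the class; $O(\varepsilon^2)$ is as $\varepsilon\to0$ with $H$ fixed. *)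

theory Defs
  imports "HOL-Analysis.Analysis" "HOL-Library.Landau_Symbols"
begin

text \<open>Functions on the circle are \<open>2\<pi>\<close>-periodic functions of a real angle.  Bounded functions are
  actual functions rather than classes modulo null sets, so \<open>\<parallel>\<cdot>\<parallel>\<^sub>\<infinity>\<close> is the supremum norm;
  \<open>R\<close> is not required to be invariant under changes on null sets.\<close>

definition on_circle :: "(real \<Rightarrow> real) \<Rightarrow> bool" where
  "on_circle f \<longleftrightarrow> f \<in> borel_measurable borel \<and> (\<forall>x. f (x + 2 * pi) = f x)"

definition even_fun :: "(real \<Rightarrow> real) \<Rightarrow> bool" where
  "even_fun f \<longleftrightarrow> (\<forall>x. f (- x) = f x)"

definition circ_int :: "(real \<Rightarrow> real) \<Rightarrow> real" where
  "circ_int f = (LBINT x:{-pi..pi}. f x)"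

definition sup_norm :: "(real \<Rightarrow> real) \<Rightarrow> real" where
  "sup_norm u = (SUP x. \<bar>u x\<bar>)"

text \<open>A non-integrable function has Bochner integral 0, so the last condition below entails
  integrability.\<close>

definition turning_kernel :: "(real \<Rightarrow> real) \<Rightarrow> bool" where
  "turning_kernel q \<longleftrightarrow> on_circle q \<and> (\<forall>x. 0 \<le> q x) \<and> circ_int q = 1"

definition base_kernel :: "(real \<Rightarrow> real) \<Rightarrow> bool" where
  "base_kernel q \<longleftrightarrow> turning_kernel q \<and> bounded (range q) \<and> (\<forall>x. 0 < q x) \<and> even_fun q"

definition turning_rate :: "real \<Rightarrow> nat \<Rightarrow> (real \<Rightarrow> real) \<Rightarrow> real" where
  "turning_rate \<alpha> m q = \<alpha> * (1 - circ_int (\<lambda>x. q x * cos (real m * x)))"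

definition matched_rates :: "real \<Rightarrow> nat \<Rightarrow> (real \<Rightarrow> real) \<Rightarrow> real list" where
  "matched_rates \<alpha> M q = map (\<lambda>m. turning_rate \<alpha> m q) [1..<Suc M]"

definition tangent_space :: "(real \<Rightarrow> real) \<Rightarrow> nat \<Rightarrow> (real \<Rightarrow> real) set" where
  "tangent_space q0 M =
     {u. on_circle u \<and> bounded (range u) \<and> even_fun u \<and>
         (\<forall>m\<le>M. circ_int (\<lambda>x. q0 x * u x * cos (real m * x)) = 0)}"

definition tangent_ball :: "(real \<Rightarrow> real) \<Rightarrow> nat \<Rightarrow> real \<Rightarrow> (real \<Rightarrow> real) set" where
  "tangent_ball q0 M \<epsilon> = {h \<in> tangent_space q0 M. sup_norm h \<le> \<epsilon>}"

definition perturbed :: "(real \<Rightarrow> real) \<Rightarrow> (real \<Rightarrow> real) \<Rightarrow> real \<Rightarrow> real" where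
  "perturbed q0 h = (\<lambda>x. q0 x * (1 + h x))"

definition kernel_class :: "(real \<Rightarrow> real) \<Rightarrow> nat \<Rightarrow> real \<Rightarrow> (real \<Rightarrow> real) set" where
  "kernel_class q0 M \<epsilon> = perturbed q0 ` tangent_ball q0 M \<epsilon>"

text \<open>Only the coefficients \<open>a 0, \<dots>, a M\<close> enter, so the infimum is over \<open>\<real>\<^sup>M\<^sup>+\<^sup>1\<close>.\<close>

definition L1_defect :: "(real \<Rightarrow> real) \<Rightarrow> nat \<Rightarrow> (real \<Rightarrow> real) \<Rightarrow> real" where
  "L1_defect q0 M \<Psi> =
     (INF a::nat \<Rightarrow> real. circ_int (\<lambda>x. q0 x * \<bar>\<Psi> x - (\<Sum>m\<le>M. a m * cos (real m * x))\<bar>))"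

text \<open>Frechet calculus in \<open>\<parallel>\<cdot>\<parallel>\<^sub>\<infinity>\<close> on a linear space \<open>V\<close> of bounded functions.  The space depends
  on \<open>q0\<close> and \<open>M\<close> and so is not a type, which rules out \<open>has_derivative\<close>.\<close>

definition bounded_linear_form_on :: "(real \<Rightarrow> real) set \<Rightarrow> ((real \<Rightarrow> real) \<Rightarrow> real) \<Rightarrow> bool" where
  "bounded_linear_form_on V L \<longleftrightarrow>
     (\<forall>u\<in>V. \<forall>v\<in>V. L (\<lambda>x. u x + v x) = L u + L v) \<and>
     (\<forall>c. \<forall>u\<in>V. L (\<lambda>x. c * u x) = c * L u) \<and>
     (\<exists>K. \<forall>u\<in>V. \<bar>L u\<bar> \<le> K * sup_norm u)"

definition bounded_bilinear_form_on ::
    "(real \<Rightarrow> real) set \<Rightarrow> ((real \<Rightarrow> real) \<Rightarrow> (real \<Rightarrow> real) \<Rightarrow> real) \<Rightarrow> bool" where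
  "bounded_bilinear_form_on V B \<longleftrightarrow>
     (\<forall>u\<in>V. bounded_linear_form_on V (\<lambda>v. B u v)) \<and>
     (\<forall>v\<in>V. bounded_linear_form_on V (\<lambda>u. B u v)) \<and>
     (\<exists>K. \<forall>u\<in>V. \<forall>v\<in>V. \<bar>B u v\<bar> \<le> K * sup_norm u * sup_norm v)"

text \<open>Operator norm; meaningful only for bounded \<open>B\<close>, as otherwise the real supremum is unspecified.\<close>

definition bilinear_norm_on ::
    "(real \<Rightarrow> real) set \<Rightarrow> ((real \<Rightarrow> real) \<Rightarrow> (real \<Rightarrow> real) \<Rightarrow> real) \<Rightarrow> real" where
  "bilinear_norm_on V B =
     (SUP (u, v) \<in> {u \<in> V. sup_norm u \<le> 1} \<times> {v \<in> V. sup_norm v \<le> 1}. \<bar>B u v\<bar>)"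

text \<open>\<open>F\<close> is \<open>C\<^sup>2\<close> on \<open>S \<subseteq> V\<close> with first and second derivatives \<open>DF\<close> and \<open>D2F\<close>.  Derivatives are
  relative to \<open>S\<close>, so a \<open>C\<^sup>2\<close> function on a relatively open neighbourhood of \<open>S\<close> in \<open>V\<close>
  qualifies.  The three limit clauses say that \<open>DF h\<close> is the derivative of \<open>F\<close>, that \<open>D2F h\<close> is
  the derivative of \<open>DF\<close> in operator norm, and that \<open>D2F\<close> is continuous in the norm of
  bilinear forms.\<close>

definition C2_on ::
    "(real \<Rightarrow> real) set \<Rightarrow> (real \<Rightarrow> real) set \<Rightarrow> ((real \<Rightarrow> real) \<Rightarrow> real)
     \<Rightarrow> ((real \<Rightarrow> real) \<Rightarrow> (real \<Rightarrow> real) \<Rightarrow> real)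
     \<Rightarrow> ((real \<Rightarrow> real) \<Rightarrow> (real \<Rightarrow> real) \<Rightarrow> (real \<Rightarrow> real) \<Rightarrow> real) \<Rightarrow> bool" where
  "C2_on V S F DF D2F \<longleftrightarrow>
     (\<forall>h\<in>S. bounded_linear_form_on V (DF h) \<and> bounded_bilinear_form_on V (D2F h)) \<and>
     (\<forall>h\<in>S. \<forall>e>0. \<exists>d>0. \<forall>k\<in>S. sup_norm (\<lambda>x. k x - h x) < d \<longrightarrow>
        \<bar>F k - F h - DF h (\<lambda>x. k x - h x)\<bar> \<le> e * sup_norm (\<lambda>x. k x - h x)) \<and>
     (\<forall>h\<in>S. \<forall>e>0. \<exists>d>0. \<forall>k\<in>S. sup_norm (\<lambda>x. k x - h x) < d \<longrightarrow>
        (\<forall>v\<in>V. \<bar>DF k v - DF h v - D2F h (\<lambda>x. k x - h x) v\<bar>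
                 \<le> e * sup_norm (\<lambda>x. k x - h x) * sup_norm v)) \<and>
     (\<forall>h\<in>S. \<forall>e>0. \<exists>d>0. \<forall>k\<in>S. sup_norm (\<lambda>x. k x - h x) < d \<longrightarrow>
        (\<forall>u\<in>V. \<forall>v\<in>V. \<bar>D2F k u v - D2F h u v\<bar> \<le> e * sup_norm u * sup_norm v))"

text \<open>Suprema and infima of outputs and errors live in \<open>ereal\<close>, since \<open>R\<close> may be unbounded on an
  arbitrary class.\<close>

definition sup_output :: "((real \<Rightarrow> real) \<Rightarrow> real) \<Rightarrow> (real \<Rightarrow> real) set \<Rightarrow> ereal" where
  "sup_output R A = (SUP q\<in>A. ereal (R q))"

definition inf_output :: "((real \<Rightarrow> real) \<Rightarrow> real) \<Rightarrow> (real \<Rightarrow> real) set \<Rightarrow> ereal" where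
  "inf_output R A = (INF q\<in>A. ereal (R q))"

definition best_constant_error :: "((real \<Rightarrow> real) \<Rightarrow> real) \<Rightarrow> (real \<Rightarrow> real) set \<Rightarrow> ereal" where
  "best_constant_error R A = (INF a::real. SUP q\<in>A. ereal \<bar>R q - a\<bar>)"

text \<open>A predictor restricted to the data \<open>data q\<close> of a kernel is a function \<open>P\<close> of those data.\<close>

definition worst_case_error ::
    "((real \<Rightarrow> real) \<Rightarrow> real) \<Rightarrow> ((real \<Rightarrow> real) \<Rightarrow> 'd) \<Rightarrow> (real \<Rightarrow> real) set \<Rightarrow> ('d \<Rightarrow> real) \<Rightarrow> ereal" where
  "worst_case_error R data A P = (SUP q\<in>A. ereal \<bar>R q - P (data q)\<bar>)"

definition minimax_error ::
    "((real \<Rightarrow> real) \<Rightarrow> real) \<Rightarrow> ((real \<Rightarrow> real) \<Rightarrow> 'd) \<Rightarrow> (real \<Rightarrow> real) set \<Rightarrow> ereal" where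
  "minimax_error R data A = (INF P. worst_case_error R data A P)"

end

theory Submission
  imports Defs
begin

text \<open>Part (a).  On a class with common data a predictor is a constant, and the constant \<open>a\<close> has
  worst-case error at most \<open>e\<close> exactly when all outputs lie in \<open>[a - e, a + e]\<close>.  Such an interval
  exists iff \<open>2 * e\<close> is at least the length of the range of outputs, and its centre may then be
  taken to be the midpoint of the range.  The class of part (b) has common data because the
  orthogonality relations defining the tangent space annihilate the perturbation of every rate.

  Part (b).  A tangent ball is star-shaped about \<open>0\<close>, so Taylor's formula along \<open>t \<mapsto> t * h\<close>
  (\<open>C2_second_order_remainder\<close>) replaces \<open>R\<close> by its linearisation
  \<open>R q0 + \<integral> q0 * h * \<Psi>\<close> at the cost of \<open>r = H * \<epsilon>\<^sup>2 / 2\<close>.  It remains to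
  see that the linear form \<open>h \<mapsto> \<integral> q0 * h * \<Psi>\<close> has supremum \<open>\<epsilon> * D\<close> over the tangent ball
  of radius \<open>\<epsilon>\<close>, where \<open>D\<close> is the distance from \<open>\<Psi>\<close> to the cosine polynomials in
  \<open>L\<^sup>1(q0)\<close>; its infimum is then \<open>- \<epsilon> * D\<close> by the symmetry \<open>h \<mapsto> - h\<close>.
  The upper bound (\<open>weak_duality\<close>) is immediate, as \<open>\<Psi>\<close> may be changed by any cosine
  polynomial without changing the integral against a tangent vector.

  The lower bound (\<open>near_extremal_tangent\<close>) is the \<open>L\<^sup>1\<close>-\<open>L\<^sup>\<infinity>\<close> duality that is usually drawn from
  the Hahn-Banach theorem.  Here it comes from a minimisation in finitely many variables: the
  absolute value in the \<open>L\<^sup>1\<close> distance is replaced by the smooth function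
  \<open>sqrt (v\<^sup>2 + d\<^sup>2)\<close>, and the resulting functional of the coefficients of the polynomial is
  minimised.  With \<open>w\<close> the difference of \<open>\<Psi>\<close> and the minimising polynomial, stationarity says
  precisely that the smoothed sign \<open>h = w / sqrt (w\<^sup>2 + d\<^sup>2)\<close> is orthogonal to the cosines, so
  \<open>h\<close> is a tangent vector with \<open>\<bar>h\<bar> \<le> 1\<close>, and \<open>\<integral> q0 * h * \<Psi> = \<integral> q0 * h * w\<close> falls short
  of \<open>D\<close> by at most \<open>d\<close>.  Smoothing avoids a discussion of the set where \<open>w\<close> vanishes.  A
  minimiser exists because the functional is coercive (\<open>weighted_coeff_bound\<close>).\<close>

section \<open>Integrals of bounded functions over the circle\<close>

definition bounded_borel :: "(real \<Rightarrow> real) set" where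
  "bounded_borel = {f. f \<in> borel_measurable borel \<and> bounded (range f)}"

lemma bounded_borelI:
  assumes "f \<in> borel_measurable borel" "\<And>x. \<bar>f x\<bar> \<le> B"
  shows "f \<in> bounded_borel"
  using assms by (auto simp: bounded_borel_def bounded_iff)

lemma bounded_borelE:
  assumes "f \<in> bounded_borel"
  obtains B where "f \<in> borel_measurable borel" "\<And>x. \<bar>f x\<bar> \<le> B" "0 \<le> B"
proof -
  from assms obtain B where "f \<in> borel_measurable borel" "\<And>x. \<bar>f x\<bar> \<le> B"
    by (auto simp: bounded_borel_def bounded_iff)
  moreover have "0 \<le> B" using calculation(2)[of 0] by linarith
  ultimately show thesis using that by blast
qed

named_theorems bounded_borel_intros

lemma bounded_borel_const [bounded_borel_intros]: "(\<lambda>x. c) \<in> bounded_borel"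
  by (rule bounded_borelI[where B="\<bar>c\<bar>"]) auto

lemma bounded_borel_cos [bounded_borel_intros]: "(\<lambda>x. cos (c * x)) \<in> bounded_borel"
  by (rule bounded_borelI[where B=1]) auto

lemma bounded_borel_add [bounded_borel_intros]:
  assumes "f \<in> bounded_borel" "g \<in> bounded_borel"
  shows "(\<lambda>x. f x + g x) \<in> bounded_borel"
proof -
  obtain B where [measurable]: "f \<in> borel_measurable borel" and B: "\<And>x. \<bar>f x\<bar> \<le> B"
    using bounded_borelE[OF assms(1)] by blast
  obtain C where [measurable]: "g \<in> borel_measurable borel" and C: "\<And>x. \<bar>g x\<bar> \<le> C"
    using bounded_borelE[OF assms(2)] by blast
  have "\<bar>f x + g x\<bar> \<le> B + C" for x using B[of x] C[of x] by linarith
  then show ?thesis by (intro bounded_borelI[where B="B+C"]) auto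
qed

lemma bounded_borel_mult [bounded_borel_intros]:
  assumes "f \<in> bounded_borel" "g \<in> bounded_borel"
  shows "(\<lambda>x. f x * g x) \<in> bounded_borel"
proof -
  obtain B where [measurable]: "f \<in> borel_measurable borel" and B: "\<And>x. \<bar>f x\<bar> \<le> B" "0 \<le> B"
    using bounded_borelE[OF assms(1)] by blast
  obtain C where [measurable]: "g \<in> borel_measurable borel" and C: "\<And>x. \<bar>g x\<bar> \<le> C"
    using bounded_borelE[OF assms(2)] by blast
  have "\<bar>f x * g x\<bar> \<le> B * C" for x
    unfolding abs_mult using B C by (intro mult_mono) auto
  then show ?thesis by (intro bounded_borelI[where B="B*C"]) auto
qed

lemma bounded_borel_abs [bounded_borel_intros]:
  assumes "f \<in> bounded_borel"
  shows "(\<lambda>x. \<bar>f x\<bar>) \<in> bounded_borel"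
proof -
  obtain B where [measurable]: "f \<in> borel_measurable borel" and B: "\<And>x. \<bar>f x\<bar> \<le> B"
    using bounded_borelE[OF assms] by blast
  show ?thesis using B by (intro bounded_borelI[where B=B]) auto
qed

lemma bounded_borel_diff [bounded_borel_intros]:
  assumes "f \<in> bounded_borel" "g \<in> bounded_borel"
  shows "(\<lambda>x. f x - g x) \<in> bounded_borel"
  using bounded_borel_add[OF assms(1) bounded_borel_mult[OF bounded_borel_const[of "-1"] assms(2)]] by simp

lemma bounded_borel_sum [bounded_borel_intros]:
  assumes "\<And>i. i \<in> I \<Longrightarrow> f i \<in> bounded_borel"
  shows "(\<lambda>x. \<Sum>i\<in>I. f i x) \<in> bounded_borel"
  using assms by (induction I rule: infinite_finite_induct) (auto intro!: bounded_borel_intros)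

lemma bounded_borel_sqrt_sum_squares [bounded_borel_intros]:
  assumes "f \<in> bounded_borel"
  shows "(\<lambda>x. sqrt ((f x)\<^sup>2 + d\<^sup>2)) \<in> bounded_borel"
proof -
  obtain B where [measurable]: "f \<in> borel_measurable borel" and B: "\<And>x. \<bar>f x\<bar> \<le> B"
    using bounded_borelE[OF assms(1)] by blast
  have "\<bar>sqrt ((f x)\<^sup>2 + d\<^sup>2)\<bar> \<le> B + \<bar>d\<bar>" for x
    using B[of x] sqrt_sum_squares_le_sum_abs[of "f x" d] by simp
  then show ?thesis by (intro bounded_borelI[where B="B+\<bar>d\<bar>"]) auto
qed

lemma circ_int_restrict: "circ_int f = integral\<^sup>L (restrict_space lborel {-pi..pi}) f"
  by (simp add: circ_int_def set_lebesgue_integral_def integral_restrict_space)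

lemma finite_circle: "finite_measure (restrict_space lborel {-pi..pi})"
  by (rule finite_measureI) (simp add: emeasure_restrict_space space_restrict_space)

lemma bounded_borel_integrable:
  assumes "f \<in> bounded_borel"
  shows "integrable (restrict_space lborel {-pi..pi}) f"
proof -
  obtain B where "f \<in> borel_measurable borel" "\<And>x. \<bar>f x\<bar> \<le> B"
    using bounded_borelE[OF assms(1)] by blast
  then show ?thesis
    by (intro finite_measure.integrable_const_bound[OF finite_circle, where B=B])
       (auto intro!: measurable_restrict_space1)
qed

lemma circ_int_add:
  "f \<in> bounded_borel \<Longrightarrow> g \<in> bounded_borel \<Longrightarrow>
     circ_int (\<lambda>x. f x + g x) = circ_int f + circ_int g"
  by (simp add: circ_int_restrict bounded_borel_integrable)

lemma circ_int_diff:
  "f \<in> bounded_borel \<Longrightarrow> g \<in> bounded_borel \<Longrightarrow>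
     circ_int (\<lambda>x. f x - g x) = circ_int f - circ_int g"
  by (simp add: circ_int_restrict bounded_borel_integrable)

lemma circ_int_cmult: "circ_int (\<lambda>x. c * f x) = c * circ_int f"
  by (simp add: circ_int_restrict)

lemma circ_int_sum:
  "(\<And>i. i \<in> I \<Longrightarrow> f i \<in> bounded_borel) \<Longrightarrow>
     circ_int (\<lambda>x. \<Sum>i\<in>I. f i x) = (\<Sum>i\<in>I. circ_int (f i))"
  by (simp add: circ_int_restrict bounded_borel_integrable)

lemma circ_int_mono:
  "f \<in> bounded_borel \<Longrightarrow> g \<in> bounded_borel \<Longrightarrow> (\<And>x. f x \<le> g x) \<Longrightarrow> circ_int f \<le> circ_int g"
  by (simp add: circ_int_restrict bounded_borel_integrable integral_mono)

lemma circ_int_nonneg: "(\<And>x. 0 \<le> f x) \<Longrightarrow> 0 \<le> circ_int f"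
  by (simp add: circ_int_restrict)

lemma circ_int_abs_le: "\<bar>circ_int f\<bar> \<le> circ_int (\<lambda>x. \<bar>f x\<bar>)"
  unfolding circ_int_restrict by (rule integral_abs_bound)

section \<open>Coefficients of a cosine polynomial\<close>

lemma circ_int_cos:
  fixes n :: int
  shows "circ_int (\<lambda>x. cos (real_of_int n * x)) = (if n = 0 then 2 * pi else 0)"
proof (cases "n = 0")
  case True
  then show ?thesis
    by (simp add: circ_int_restrict measure_restrict_space space_restrict_space)
next
  case False
  have "(\<integral>x. cos (real_of_int n * x) * indicator {-pi..pi} x \<partial>lborel) =
      sin (real_of_int n * pi) / n - sin (real_of_int n * - pi) / n"
    using False
    by (intro integral_FTC_Icc_real) (auto intro!: derivative_eq_intros continuous_intros)
  moreover have "sin (real_of_int n * pi) = 0"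
    by (simp add: sin_integer_2pi sin_zero_iff_int2)
  ultimately show ?thesis using False
    by (simp add: circ_int_def set_lebesgue_integral_def mult.commute)
qed

text \<open>The orthogonality of the cosines makes the coefficients of a cosine polynomial readable from
  integrals, and so bounds them by the \<open>L\<^sup>1\<close> norm.\<close>

lemma circ_int_cos_cos:
  "circ_int (\<lambda>x. cos (real k * x) * cos (real m * x)) =
     (if k = m then if m = 0 then 2 * pi else pi else 0)"
proof -
  have "cos (real k * x) * cos (real m * x) =
      1/2 * (cos (real_of_int (int k - int m) * x) + cos (real_of_int (int k + int m) * x))" for x
    by (simp add: cos_times_cos algebra_simps)
  then have "circ_int (\<lambda>x. cos (real k * x) * cos (real m * x)) =
      1/2 * (circ_int (\<lambda>x. cos (real_of_int (int k - int m) * x)) +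
             circ_int (\<lambda>x. cos (real_of_int (int k + int m) * x)))"
    by (simp only: circ_int_cmult circ_int_add bounded_borel_intros)
  then show ?thesis unfolding circ_int_cos by auto
qed

definition cos_poly :: "nat \<Rightarrow> (nat \<Rightarrow> real) \<Rightarrow> real \<Rightarrow> real" where
  "cos_poly M a x = (\<Sum>m\<le>M. a m * cos (real m * x))"

lemma bounded_borel_cos_poly [bounded_borel_intros]: "cos_poly M a \<in> bounded_borel"
proof -
  have "(\<lambda>x. \<Sum>m\<le>M. a m * cos (real m * x)) \<in> bounded_borel" by (intro bounded_borel_intros)
  then show ?thesis by (simp add: cos_poly_def[abs_def])
qed

lemma cos_poly_coeff_bound:
  assumes "m \<le> M"
  shows "pi * \<bar>a m\<bar> \<le> circ_int (\<lambda>x. \<bar>cos_poly M a x\<bar>)"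
proof -
  have "circ_int (\<lambda>x. cos_poly M a x * cos (real m * x)) =
      (\<Sum>k\<le>M. a k * circ_int (\<lambda>x. cos (real k * x) * cos (real m * x)))"
    by (simp add: cos_poly_def sum_distrib_right circ_int_sum bounded_borel_intros mult.assoc
        flip: circ_int_cmult)
  also have "\<dots> = (\<Sum>k\<le>M. if k = m then a m * (if m = 0 then 2 * pi else pi) else 0)"
    by (intro sum.cong) (auto simp: circ_int_cos_cos)
  also have "\<dots> = a m * (if m = 0 then 2 * pi else pi)" using assms by simp
  finally have "pi * \<bar>a m\<bar> \<le> \<bar>circ_int (\<lambda>x. cos_poly M a x * cos (real m * x))\<bar>"
    by (simp add: abs_mult mult.commute)
  also have "\<dots> \<le> circ_int (\<lambda>x. \<bar>cos_poly M a x * cos (real m * x)\<bar>)"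
    by (rule circ_int_abs_le)
  also have "\<dots> \<le> circ_int (\<lambda>x. \<bar>cos_poly M a x\<bar>)"
    by (intro circ_int_mono bounded_borel_intros) (simp add: abs_mult mult_left_le)
  finally show ?thesis .
qed

text \<open>A positive weight need not be bounded away from \<open>0\<close>.  The inequality
  \<open>1 \<le> n * q x + max 0 (1 - n * q x)\<close> compares Lebesgue measure with the weighted one up to a
  remainder, which is small for large \<open>n\<close> by dominated convergence.\<close>

lemma positive_weight_truncation:
  assumes q: "q \<in> bounded_borel" "\<And>x. 0 < q x" and e: "0 < e"
  shows "\<exists>n::nat. circ_int (\<lambda>x. max 0 (1 - real n * q x)) < e"
proof -
  let ?N = "restrict_space lborel {-pi..pi}"
  have qm [measurable]: "q \<in> borel_measurable ?N"
    using bounded_borel_integrable[OF q(1)] by (rule borel_measurable_integrable)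
  have "(\<lambda>n. integral\<^sup>L ?N (\<lambda>x. max 0 (1 - real n * q x))) \<longlonglongrightarrow> integral\<^sup>L ?N (\<lambda>x. 0)"
  proof (rule integral_dominated_convergence[where w="\<lambda>x. 1"])
    show "integrable ?N (\<lambda>x. 1::real)" by (intro bounded_borel_integrable bounded_borel_intros)
    show "AE x in ?N. (\<lambda>n. max 0 (1 - real n * q x)) \<longlonglongrightarrow> 0"
    proof (rule AE_I2)
      fix x
      obtain n0 :: nat where n0: "1 < real n0 * q x"
        using reals_Archimedean3[OF q(2)[of x]] by blast
      have "max 0 (1 - real n * q x) = 0" if "n \<ge> n0" for n
      proof -
        have "real n0 * q x \<le> real n * q x" using that q(2)[of x] by simp
        with n0 show ?thesis by simp
      qed
      then have "\<forall>\<^sub>F n in sequentially. max 0 (1 - real n * q x) = 0"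
        by (auto simp: eventually_sequentially)
      then show "(\<lambda>n. max 0 (1 - real n * q x)) \<longlonglongrightarrow> 0"
        by (rule tendsto_eventually)
    qed
    show "AE x in ?N. norm (max 0 (1 - real n * q x)) \<le> 1" for n
    proof (rule AE_I2)
      fix x
      have "0 \<le> real n * q x" using q(2)[of x] by simp
      then show "norm (max 0 (1 - real n * q x)) \<le> 1" by simp
    qed
  qed auto
  then have "(\<lambda>n. circ_int (\<lambda>x. max 0 (1 - real n * q x))) \<longlonglongrightarrow> 0"
    by (simp add: circ_int_restrict)
  then have "\<forall>\<^sub>F n in sequentially. circ_int (\<lambda>x. max 0 (1 - real n * q x)) < e"
    using e by (rule order_tendstoD)
  then show ?thesis by (auto simp: eventually_sequentially)
qed

text \<open>Coercivity in the weighted norm.  The remainder left by the comparison of the unweighted with the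
  weighted integral is multiplied by the maximum of the polynomial, hence by at most the sum of the moduli of
  its coefficients; that sum is itself bounded by the unweighted \<open>L\<^sup>1\<close> norm, so a small enough
  remainder can be absorbed into the left-hand side.\<close>

lemma weighted_coeff_bound:
  assumes q: "q \<in> bounded_borel" "\<And>x. 0 < q x"
  shows "\<exists>c>0. \<forall>a. \<forall>m\<le>M. \<bar>a m\<bar> \<le> c * circ_int (\<lambda>x. q x * \<bar>cos_poly M a x\<bar>)"
proof -
  \<comment> \<open>Chosen so that the remainder is at most half of the unweighted norm.\<close>
  define e where "e = pi / (2 * real (Suc M))"
  have "0 < e" by (simp add: e_def)
  then obtain n :: nat where n: "circ_int (\<lambda>x. max 0 (1 - real n * q x)) < e"
    using positive_weight_truncation[OF q] by blast
  have tb: "(\<lambda>x. max 0 (1 - real n * q x)) \<in> bounded_borel"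
  proof (rule bounded_borelI[where B=1])
    show "(\<lambda>x. max 0 (1 - real n * q x)) \<in> borel_measurable borel"
      using q(1) by (auto simp: bounded_borel_def)
    fix x
    have "0 \<le> real n * q x" using q(2)[of x] by simp
    then show "\<bar>max 0 (1 - real n * q x)\<bar> \<le> 1" by simp
  qed
  have "\<bar>a m\<bar> \<le> real (Suc n) * circ_int (\<lambda>x. q x * \<bar>cos_poly M a x\<bar>)" if m: "m \<le> M" for a m
  proof -
    let ?I = "circ_int (\<lambda>x. \<bar>cos_poly M a x\<bar>)" and ?J = "circ_int (\<lambda>x. q x * \<bar>cos_poly M a x\<bar>)"
    let ?s = "\<Sum>m\<le>M. \<bar>a m\<bar>"
    have J: "0 \<le> ?J" using q(2) by (intro circ_int_nonneg) (simp add: less_imp_le)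
    have sup: "\<bar>cos_poly M a x\<bar> \<le> ?s" for x
      unfolding cos_poly_def
      by (rule order_trans[OF sum_abs]) (auto intro!: sum_mono simp: abs_mult mult_left_le)
    have "pi * ?s \<le> (\<Sum>m\<le>M. ?I)"
      unfolding sum_distrib_left by (intro sum_mono cos_poly_coeff_bound) simp
    then have s: "pi * ?s \<le> real (Suc M) * ?I" by simp
    have "?I \<le> circ_int (\<lambda>x. real n * (q x * \<bar>cos_poly M a x\<bar>) + ?s * max 0 (1 - real n * q x))"
    proof (rule circ_int_mono)
      fix x
      have "\<bar>cos_poly M a x\<bar> * 1 \<le> \<bar>cos_poly M a x\<bar> * (real n * q x + max 0 (1 - real n * q x))"
        by (intro mult_left_mono) auto
      also have "\<dots> \<le> real n * (q x * \<bar>cos_poly M a x\<bar>) + ?s * max 0 (1 - real n * q x)"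
        using mult_right_mono[OF sup[of x], of "max 0 (1 - real n * q x)"]
        by (simp add: algebra_simps)
      finally show "\<bar>cos_poly M a x\<bar> \<le> real n * (q x * \<bar>cos_poly M a x\<bar>) + ?s * max 0 (1 - real n * q x)"
        by simp
    qed (intro bounded_borel_intros tb q)+
    also have "\<dots> = real n * ?J + ?s * circ_int (\<lambda>x. max 0 (1 - real n * q x))"
      by (subst circ_int_add) (intro bounded_borel_intros tb q | simp add: circ_int_cmult)+
    also have "\<dots> \<le> real n * ?J + ?s * e"
      using n by (intro add_left_mono mult_left_mono) (auto intro: sum_nonneg)
    also have "?s * e \<le> ?I / 2" using s by (simp add: e_def field_simps)
    finally have "?I \<le> 2 * real n * ?J" by simp
    with cos_poly_coeff_bound[OF m, of a] have "pi * \<bar>a m\<bar> \<le> 2 * real n * ?J" by linarith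
    moreover have "2 * \<bar>a m\<bar> \<le> pi * \<bar>a m\<bar>" using pi_ge_two by (intro mult_right_mono) auto
    ultimately have "\<bar>a m\<bar> \<le> real n * ?J" by linarith
    then show ?thesis using J by (simp add: algebra_simps)
  qed
  then show ?thesis by (intro exI[of _ "real (Suc n)"]) auto
qed

text \<open>The number of variables is not fixed by a type, so coefficient vectors are sequences with the
  product topology, and compactness of the box of admissible coefficients comes from Tychonoff's
  theorem.  The Lipschitz hypothesis gives continuity and also that only the coordinates up to
  \<open>M\<close> matter, so that the others may be set to \<open>0\<close>.\<close>

lemma coercive_attains_min:
  fixes J :: "(nat \<Rightarrow> real) \<Rightarrow> real"
  assumes lip: "\<And>a b. \<bar>J a - J b\<bar> \<le> L * (\<Sum>m\<le>M. \<bar>a m - b m\<bar>)"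
    and coer: "\<And>a m. J a \<le> J (\<lambda>_. 0) \<Longrightarrow> m \<le> M \<Longrightarrow> \<bar>a m\<bar> \<le> K"
  shows "\<exists>a. \<forall>b. J a \<le> J b"
proof -
  define X where "X = PiE UNIV (\<lambda>m. if m \<le> M then {-K..K} else {0::real})"
  have K: "0 \<le> K" using coer[of "\<lambda>_. 0" 0] by simp
  have "compactin (product_topology (\<lambda>_. euclideanreal) UNIV) X"
    unfolding X_def by (subst compactin_PiE) (simp add: compactin_euclidean_iff)
  then have "compact X" unfolding euclidean_product_topology compactin_euclidean_iff .
  moreover have "X \<noteq> {}" using K by (auto simp: X_def PiE_eq_empty_iff)
  moreover have "continuous_on X J"
    unfolding continuous_on_def
  proof
    fix a assume "a \<in> X"
    have co: "((\<lambda>b. b m) \<longlongrightarrow> a m) (at a within X)" for m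
      using continuous_on_product_coordinates[of m]
      by (metis UNIV_I continuous_on_def tendsto_within_subset top_greatest)
    have "((\<lambda>b. L * (\<Sum>m\<le>M. \<bar>b m - a m\<bar>)) \<longlongrightarrow> L * (\<Sum>m\<le>M. \<bar>a m - a m\<bar>)) (at a within X)"
      by (intro tendsto_intros co)
    then have "((\<lambda>b. L * (\<Sum>m\<le>M. \<bar>b m - a m\<bar>)) \<longlongrightarrow> 0) (at a within X)" by simp
    then have "((\<lambda>b. J b - J a) \<longlongrightarrow> 0) (at a within X)"
      by (rule Lim_null_comparison[rotated]) (use lip in auto)
    then show "(J \<longlongrightarrow> J a) (at a within X)" by (simp add: LIM_zero_iff)
  qed
  ultimately obtain a where a: "a \<in> X" "\<And>b. b \<in> X \<Longrightarrow> J a \<le> J b"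
    using continuous_attains_inf by metis
  have "J a \<le> J b" for b
  proof (cases "J b \<le> J (\<lambda>_. 0)")
    case True
    define b' where "b' m = (if m \<le> M then b m else 0)" for m
    have "b' \<in> X" using coer[OF True] by (fastforce simp: X_def b'_def abs_le_iff PiE_iff)
    moreover have "J b' = J b" using lip[of b' b] by (simp add: b'_def)
    ultimately show ?thesis using a(2) by metis
  next
    case False
    moreover have "(\<lambda>_. 0) \<in> X" using K by (auto simp: X_def)
    ultimately show ?thesis using a(2) by fastforce
  qed
  then show ?thesis by blast
qed

section \<open>Second-order Taylor bound on a space of bounded functions\<close>

lemma sup_norm_upper:
  assumes "bounded (range u)" shows "\<bar>u x\<bar> \<le> sup_norm u"
proof -
  have "bdd_above (range (\<lambda>x. \<bar>u x\<bar>))"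
    using assms by (auto simp: bounded_iff bdd_above_def)
  then show ?thesis unfolding sup_norm_def by (rule cSUP_upper[OF UNIV_I])
qed

lemma sup_norm_le: "(\<And>x. \<bar>u x\<bar> \<le> B) \<Longrightarrow> sup_norm u \<le> B"
  unfolding sup_norm_def by (rule cSUP_least) auto

lemma sup_norm_nonneg: "bounded (range u) \<Longrightarrow> 0 \<le> sup_norm u"
  using sup_norm_upper[of u 0] by linarith

lemma sup_norm_scale:
  assumes "bounded (range u)"
  shows "sup_norm (\<lambda>x. c * u x) = \<bar>c\<bar> * sup_norm u"
proof (cases "c = 0")
  case True
  then show ?thesis by (simp add: sup_norm_def)
next
  case False
  have b: "bounded (range (\<lambda>x. c * u x))"
    using bounded_scaling[OF assms, of c] by (simp add: image_image)
  show ?thesis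
  proof (rule antisym)
    show "sup_norm (\<lambda>x. c * u x) \<le> \<bar>c\<bar> * sup_norm u"
      by (rule sup_norm_le) (simp add: abs_mult mult_left_mono sup_norm_upper assms)
    have "sup_norm u \<le> sup_norm (\<lambda>x. c * u x) / \<bar>c\<bar>"
      using False sup_norm_upper[OF b] by (intro sup_norm_le) (simp add: field_simps abs_mult)
    then show "\<bar>c\<bar> * sup_norm u \<le> sup_norm (\<lambda>x. c * u x)"
      using False by (simp add: field_simps)
  qed
qed

lemma abs_le_bilinear_norm:
  assumes V: "\<And>u. u \<in> V \<Longrightarrow> bounded (range u)"
    and B: "bounded_bilinear_form_on V B"
    and uv: "u \<in> V" "v \<in> V" "sup_norm u \<le> 1" "sup_norm v \<le> 1"
  shows "\<bar>B u v\<bar> \<le> bilinear_norm_on V B"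
proof -
  obtain K where K: "\<And>u v. u \<in> V \<Longrightarrow> v \<in> V \<Longrightarrow> \<bar>B u v\<bar> \<le> K * sup_norm u * sup_norm v"
    using B unfolding bounded_bilinear_form_on_def by blast
  let ?S = "{u \<in> V. sup_norm u \<le> 1} \<times> {v \<in> V. sup_norm v \<le> 1}"
  have "bdd_above ((\<lambda>(u, v). \<bar>B u v\<bar>) ` ?S)"
  proof (rule bdd_aboveI)
    fix y assume "y \<in> (\<lambda>(u, v). \<bar>B u v\<bar>) ` ?S"
    then obtain a b where ab: "a \<in> V" "b \<in> V" "sup_norm a \<le> 1" "sup_norm b \<le> 1" "y = \<bar>B a b\<bar>"
      by auto
    have "y \<le> K * (sup_norm a * sup_norm b)" using K[OF ab(1,2)] ab(5) by (simp add: mult.assoc)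
    also have "\<dots> \<le> \<bar>K\<bar> * (1 * 1)"
      using ab sup_norm_nonneg V by (intro mult_mono) auto
    finally show "y \<le> \<bar>K\<bar>" by simp
  qed
  then have "(\<lambda>(u, v). \<bar>B u v\<bar>) (u, v) \<le> bilinear_norm_on V B"
    unfolding bilinear_norm_on_def by (rule cSUP_upper[rotated]) (use uv in auto)
  then show ?thesis by simp
qed

lemma bilinear_norm_bound:
  assumes V: "\<And>u c. u \<in> V \<Longrightarrow> (\<lambda>x. c * u x) \<in> V" "\<And>u. u \<in> V \<Longrightarrow> bounded (range u)"
    and B: "bounded_bilinear_form_on V B" and H: "bilinear_norm_on V B \<le> H"
    and u: "u \<in> V"
  shows "\<bar>B u u\<bar> \<le> H * (sup_norm u)\<^sup>2"
proof -
  let ?n = "sup_norm u"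
  have n0: "0 \<le> ?n" by (rule sup_norm_nonneg[OF V(2)[OF u]])
  show ?thesis
  proof (cases "?n = 0")
    case True
    then show ?thesis
      using B u unfolding bounded_bilinear_form_on_def by fastforce
  next
    case False
    define v where "v = (\<lambda>x. (1 / ?n) * u x)"
    have v: "v \<in> V" unfolding v_def by (rule V(1)[OF u])
    have nv: "sup_norm v = 1"
      using n0 False unfolding v_def by (subst sup_norm_scale[OF V(2)[OF u]]) simp
    have "\<bar>B v v\<bar> \<le> bilinear_norm_on V B"
      by (rule abs_le_bilinear_norm[OF V(2) B v v]) (simp_all add: nv)
    also have "B v v = (1 / ?n) * ((1 / ?n) * B u u)"
      using B u v unfolding bounded_bilinear_form_on_def bounded_linear_form_on_def v_def by metis
    finally have "\<bar>B u u\<bar> \<le> bilinear_norm_on V B * ?n\<^sup>2"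
      using n0 False by (simp add: abs_mult field_simps power2_eq_square)
    also have "\<dots> \<le> H * ?n\<^sup>2" using H by (rule mult_right_mono) simp
    finally show ?thesis .
  qed
qed

text \<open>The restriction of \<open>F\<close> to the segment from \<open>0\<close> to \<open>h\<close> is a function \<open>\<phi>\<close> of one variable with
  \<open>\<phi>' = \<psi>\<close> and \<open>\<psi>' = \<omega>\<close>, and \<open>\<bar>\<omega>\<bar> \<le> H * (sup_norm h)\<^sup>2\<close>.  Derivatives are taken within the unit
  interval because \<open>S\<close> need not extend beyond the segment.\<close>

lemma C2_second_order_remainder:
  assumes V: "\<And>u c. u \<in> V \<Longrightarrow> (\<lambda>x. c * u x) \<in> V" "\<And>u. u \<in> V \<Longrightarrow> bounded (range u)"
    and C2: "C2_on V S F DF D2F"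
    and H: "\<And>h. h \<in> S \<Longrightarrow> bilinear_norm_on V (D2F h) \<le> H"
    and h: "h \<in> V" and seg: "\<And>t. 0 \<le> t \<Longrightarrow> t \<le> 1 \<Longrightarrow> (\<lambda>x. t * h x) \<in> S"
  shows "\<bar>F h - F (\<lambda>x. 0) - DF (\<lambda>x. 0) h\<bar> \<le> H / 2 * (sup_norm h)\<^sup>2"
proof -
  let ?n = "sup_norm h"
  let ?g = "\<lambda>t x. t * h x"
  define \<phi> where "\<phi> t = F (?g t)" for t
  define \<psi> where "\<psi> t = DF (?g t) h" for t
  define \<omega> where "\<omega> t = D2F (?g t) h h" for t
  have n0: "0 \<le> ?n" by (rule sup_norm_nonneg[OF V(2)[OF h]])
  have diffg: "(\<lambda>x. ?g s x - ?g t x) = ?g (s - t)" for s t by (auto simp: algebra_simps)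
  have norm: "sup_norm (?g s) = \<bar>s\<bar> * ?n" for s by (rule sup_norm_scale[OF V(2)[OF h]])
  have S: "?g t \<in> S" if "t \<in> {0..1}" for t using seg that by simp
  have lin: "DF (?g t) (?g s) = s * \<psi> t" if "t \<in> {0..1}" for s t
    using C2 S[OF that] h unfolding C2_on_def bounded_linear_form_on_def \<psi>_def by simp
  have bil: "bounded_bilinear_form_on V (D2F (?g t))" if "t \<in> {0..1}" for t
    using C2 S[OF that] unfolding C2_on_def by simp
  have lin2: "D2F (?g t) (?g s) h = s * \<omega> t" if "t \<in> {0..1}" for s t
    using bil[OF that] h
    unfolding bounded_bilinear_form_on_def bounded_linear_form_on_def \<omega>_def by simp
  from C2 have C2_first: "\<exists>d>0. \<forall>k\<in>S. sup_norm (\<lambda>x. k x - g x) < d \<longrightarrow>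
        \<bar>F k - F g - DF g (\<lambda>x. k x - g x)\<bar> \<le> e * sup_norm (\<lambda>x. k x - g x)"
    if "g \<in> S" "0 < e" for g e
    using that unfolding C2_on_def by simp
  from C2 have C2_second: "\<exists>d>0. \<forall>k\<in>S. sup_norm (\<lambda>x. k x - g x) < d \<longrightarrow>
        (\<forall>v\<in>V. \<bar>DF k v - DF g v - D2F g (\<lambda>x. k x - g x) v\<bar>
                 \<le> e * sup_norm (\<lambda>x. k x - g x) * sup_norm v)"
    if "g \<in> S" "0 < e" for g e
    using that unfolding C2_on_def by simp
  \<comment> \<open>The radii are divided by \<open>sup_norm h + 1\<close>, which is positive even for \<open>h = 0\<close>.\<close>
  have close: "\<bar>s - t\<bar> * ?n < d" if "\<bar>s - t\<bar> < d / (?n + 1)" "0 < d" for s t d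
  proof -
    have "\<bar>s - t\<bar> * ?n \<le> \<bar>s - t\<bar> * (?n + 1)" by (intro mult_left_mono) auto
    also have "\<dots> < d" using that n0 by (simp add: field_simps)
    finally show ?thesis .
  qed
  have shrink: "e / (k + 1) * k \<le> e" if "0 < e" "0 \<le> k" for e k :: real
    using that by (simp add: field_simps)
  have d1: "(\<phi> has_real_derivative \<psi> t) (at t within {0..1})" if t: "t \<in> {0..1}" for t
    unfolding has_field_derivative_def has_derivative_within_alt
  proof (intro conjI allI impI)
    show "bounded_linear ((*) (\<psi> t))" by (rule bounded_linear_mult_right)
    fix e :: real assume e: "0 < e"
    then have "0 < e / (?n + 1)" using n0 by simp
    then obtain d where d: "0 < d" "\<And>k. k \<in> S \<Longrightarrow> sup_norm (\<lambda>x. k x - ?g t x) < d \<Longrightarrow>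
        \<bar>F k - F (?g t) - DF (?g t) (\<lambda>x. k x - ?g t x)\<bar> \<le> e / (?n + 1) * sup_norm (\<lambda>x. k x - ?g t x)"
      using C2_first[OF S[OF t]] by blast
    show "\<exists>d>0. \<forall>s\<in>{0..1}. norm (s - t) < d \<longrightarrow> norm (\<phi> s - \<phi> t - \<psi> t * (s - t)) \<le> e * norm (s - t)"
    proof (intro exI[of _ "d / (?n + 1)"] conjI ballI impI)
      show "0 < d / (?n + 1)" using d n0 by simp
      fix s :: real assume s: "s \<in> {0..1}" "norm (s - t) < d / (?n + 1)"
      have "\<bar>F (?g s) - F (?g t) - DF (?g t) (?g (s - t))\<bar> \<le> e / (?n + 1) * sup_norm (?g (s - t))"
        using d(2)[OF S[OF s(1)]] s close[of s t d] d(1) unfolding diffg norm by auto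
      then have "\<bar>\<phi> s - \<phi> t - (s - t) * \<psi> t\<bar> \<le> e / (?n + 1) * ?n * \<bar>s - t\<bar>"
        unfolding lin[OF t] norm \<phi>_def by (simp add: mult.assoc mult.commute[of "?n"])
      also have "\<dots> \<le> e * \<bar>s - t\<bar>" by (intro mult_right_mono shrink e n0) auto
      finally show "norm (\<phi> s - \<phi> t - \<psi> t * (s - t)) \<le> e * norm (s - t)"
        by (simp add: mult.commute)
    qed
  qed
  have d2: "(\<psi> has_real_derivative \<omega> t) (at t within {0..1})" if t: "t \<in> {0..1}" for t
    unfolding has_field_derivative_def has_derivative_within_alt
  proof (intro conjI allI impI)
    show "bounded_linear ((*) (\<omega> t))" by (rule bounded_linear_mult_right)
    fix e :: real assume e: "0 < e"
    then have "0 < e / (?n\<^sup>2 + 1)" by (simp add: add_nonneg_pos)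
    then obtain d where d: "0 < d" "\<And>k v. k \<in> S \<Longrightarrow> sup_norm (\<lambda>x. k x - ?g t x) < d \<Longrightarrow> v \<in> V \<Longrightarrow>
        \<bar>DF k v - DF (?g t) v - D2F (?g t) (\<lambda>x. k x - ?g t x) v\<bar>
          \<le> e / (?n\<^sup>2 + 1) * sup_norm (\<lambda>x. k x - ?g t x) * sup_norm v"
      using C2_second[OF S[OF t]] by blast
    show "\<exists>d>0. \<forall>s\<in>{0..1}. norm (s - t) < d \<longrightarrow> norm (\<psi> s - \<psi> t - \<omega> t * (s - t)) \<le> e * norm (s - t)"
    proof (intro exI[of _ "d / (?n + 1)"] conjI ballI impI)
      show "0 < d / (?n + 1)" using d n0 by simp
      fix s :: real assume s: "s \<in> {0..1}" "norm (s - t) < d / (?n + 1)"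
      have "\<bar>DF (?g s) h - DF (?g t) h - D2F (?g t) (?g (s - t)) h\<bar>
          \<le> e / (?n\<^sup>2 + 1) * sup_norm (?g (s - t)) * ?n"
        using d(2)[OF S[OF s(1)] _ h] s close[of s t d] d(1) unfolding diffg norm by auto
      then have "\<bar>\<psi> s - \<psi> t - (s - t) * \<omega> t\<bar> \<le> e / (?n\<^sup>2 + 1) * ?n\<^sup>2 * \<bar>s - t\<bar>"
        unfolding lin2[OF t] norm \<psi>_def by (simp add: power2_eq_square mult_ac)
      also have "\<dots> \<le> e * \<bar>s - t\<bar>" by (intro mult_right_mono shrink e) auto
      finally show "norm (\<psi> s - \<psi> t - \<omega> t * (s - t)) \<le> e * norm (s - t)"
        by (simp add: mult.commute)
    qed
  qed
  define K where "K = H * ?n\<^sup>2"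
  have \<omega>: "\<bar>\<omega> t\<bar> \<le> K" if "t \<in> {0..1}" for t
    unfolding \<omega>_def K_def by (rule bilinear_norm_bound[OF V bil[OF that] H[OF S[OF that]] h])
  have \<psi>: "\<bar>\<psi> t - \<psi> 0\<bar> \<le> K * t" if t: "0 \<le> t" "t \<le> 1" for t
  proof -
    have "norm (\<psi> t - \<psi> 0) \<le> K * norm (t - 0)"
      by (rule field_differentiable_bound[where S="{0..1}" and f'=\<omega>]) (use d2 \<omega> t in auto)
    then show ?thesis using t by simp
  qed
  have one_sided: "c * (\<phi> 1 - \<phi> 0 - \<psi> 0) \<le> K / 2" if c: "\<bar>c\<bar> = 1" for c :: real
  proof -
    \<comment> \<open>Its derivative \<open>c * (\<psi> t - \<psi> 0) - K * t\<close> is nonpositive; \<open>c\<close> is one of the two signs.\<close>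
    let ?f = "\<lambda>t. c * (\<phi> t - t * \<psi> 0) - K * t\<^sup>2 / 2"
    have D: "(?f has_real_derivative c * (\<psi> t - \<psi> 0) - K * t) (at t within {0..1})"
      if "t \<in> {0..1}" for t
      by (auto intro!: derivative_eq_intros d1[OF that])
    have "?f 1 \<le> ?f 0"
    proof (rule DERIV_nonpos_imp_decreasing_open[of 0 1 ?f])
      show "(0::real) \<le> 1" by simp
      show "continuous_on {0..1} ?f"
        using D by (meson DERIV_continuous continuous_on_eq_continuous_within)
    next
      fix t :: real assume t: "0 < t" "t < 1"
      have "c * (\<psi> t - \<psi> 0) \<le> \<bar>c\<bar> * \<bar>\<psi> t - \<psi> 0\<bar>" by (metis abs_ge_self abs_mult)
      also have "\<dots> \<le> K * t" using \<psi>[of t] t c by simp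
      finally show "\<exists>y. (?f has_real_derivative y) (at t) \<and> y \<le> 0"
        using D[of t] t by (intro exI[of _ "c * (\<psi> t - \<psi> 0) - K * t"])
          (auto simp: at_within_Icc_at)
    qed
    then show ?thesis by (simp add: algebra_simps)
  qed
  have "\<bar>\<phi> 1 - \<phi> 0 - \<psi> 0\<bar> \<le> K / 2"
    using one_sided[of 1] one_sided[of "-1"] by (intro abs_leI) simp_all
  then show ?thesis by (simp add: \<phi>_def \<psi>_def K_def)
qed

section \<open>Duality between tangent vectors and cosine approximation\<close>

lemma L1_defect_cos_poly:
  "L1_defect q M \<Psi> = (INF a. circ_int (\<lambda>x. q x * \<bar>\<Psi> x - cos_poly M a x\<bar>))"
  by (simp add: L1_defect_def cos_poly_def)

lemma L1_defect_le:
  assumes "\<And>x. 0 \<le> q x"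
  shows "L1_defect q M \<Psi> \<le> circ_int (\<lambda>x. q x * \<bar>\<Psi> x - cos_poly M a x\<bar>)"
  unfolding L1_defect_cos_poly
  using assms by (intro cINF_lower bdd_belowI[where m=0]) (auto intro!: circ_int_nonneg)

lemma tangent_space_bounded_borel: "u \<in> tangent_space q M \<Longrightarrow> u \<in> bounded_borel"
  by (simp add: tangent_space_def on_circle_def bounded_borel_def)

lemma tangent_orthogonal:
  assumes q: "q \<in> bounded_borel" and h: "h \<in> tangent_space q M"
  shows "circ_int (\<lambda>x. q x * h x * cos_poly M a x) = 0"
proof -
  have "circ_int (\<lambda>x. q x * h x * cos_poly M a x) =
      (\<Sum>m\<le>M. circ_int (\<lambda>x. a m * (q x * h x * cos (real m * x))))"
    unfolding cos_poly_def sum_distrib_left mult.left_commute[of "q _ * h _"]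
    by (intro circ_int_sum bounded_borel_intros q tangent_space_bounded_borel[OF h])
  also have "\<dots> = 0"
    using h by (simp add: circ_int_cmult tangent_space_def)
  finally show ?thesis .
qed

text \<open>Only \<open>\<Psi>\<close> modulo cosine polynomials enters the integral against a tangent vector.\<close>

lemma weak_duality:
  assumes q: "q \<in> bounded_borel" "\<And>x. 0 \<le> q x" and \<Psi>: "\<Psi> \<in> bounded_borel"
    and h: "h \<in> tangent_ball q M \<epsilon>" and \<epsilon>: "0 < \<epsilon>"
  shows "circ_int (\<lambda>x. q x * h x * \<Psi> x) \<le> \<epsilon> * L1_defect q M \<Psi>"
proof -
  have hT: "h \<in> tangent_space q M" and hn: "sup_norm h \<le> \<epsilon>"
    using h by (auto simp: tangent_ball_def)
  have hb: "h \<in> bounded_borel" by (rule tangent_space_bounded_borel[OF hT])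
  have hx: "\<bar>h x\<bar> \<le> \<epsilon>" for x
    using sup_norm_upper[of h x] hb hn by (simp add: bounded_borel_def)
  have "circ_int (\<lambda>x. q x * h x * \<Psi> x) / \<epsilon> \<le> circ_int (\<lambda>x. q x * \<bar>\<Psi> x - cos_poly M a x\<bar>)" for a
  proof -
    have "circ_int (\<lambda>x. q x * h x * \<Psi> x) = circ_int (\<lambda>x. q x * h x * \<Psi> x - q x * h x * cos_poly M a x)"
      by (subst circ_int_diff) (intro bounded_borel_intros q \<Psi> hb | simp add: tangent_orthogonal[OF q(1) hT])+
    also have "\<dots> \<le> circ_int (\<lambda>x. \<epsilon> * (q x * \<bar>\<Psi> x - cos_poly M a x\<bar>))"
    proof (intro circ_int_mono)
      fix x
      have "h x * (\<Psi> x - cos_poly M a x) \<le> \<bar>h x\<bar> * \<bar>\<Psi> x - cos_poly M a x\<bar>"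
        by (metis abs_ge_self abs_mult)
      also have "\<dots> \<le> \<epsilon> * \<bar>\<Psi> x - cos_poly M a x\<bar>" by (intro mult_right_mono hx) simp
      finally show "q x * h x * \<Psi> x - q x * h x * cos_poly M a x \<le> \<epsilon> * (q x * \<bar>\<Psi> x - cos_poly M a x\<bar>)"
        using mult_left_mono[OF _ q(2)[of x]] by (fastforce simp: algebra_simps)
    qed (intro bounded_borel_intros q \<Psi> hb)+
    finally show ?thesis using \<epsilon> by (simp add: circ_int_cmult field_simps)
  qed
  then have "circ_int (\<lambda>x. q x * h x * \<Psi> x) / \<epsilon> \<le> L1_defect q M \<Psi>"
    unfolding L1_defect_cos_poly by (intro cINF_greatest) auto
  then show ?thesis using \<epsilon> by (simp add: field_simps)
qed

definition smooth_abs :: "real \<Rightarrow> real \<Rightarrow> real" where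
  "smooth_abs d v = sqrt (v\<^sup>2 + d\<^sup>2)"

lemma smooth_abs_ge: "0 < d \<Longrightarrow> d \<le> smooth_abs d v"
  by (simp add: smooth_abs_def real_le_rsqrt)

lemma abs_le_smooth_abs: "\<bar>v\<bar> \<le> smooth_abs d v"
  by (simp add: smooth_abs_def real_le_rsqrt)

lemma smooth_abs_sq: "(smooth_abs d v)\<^sup>2 = v\<^sup>2 + d\<^sup>2"
  by (simp add: smooth_abs_def)

lemma smooth_abs_lipschitz: "\<bar>smooth_abs d u - smooth_abs d v\<bar> \<le> \<bar>u - v\<bar>"
  using norm_triangle_ineq3[of "Complex u d" "Complex v d"]
  by (simp add: smooth_abs_def complex_norm complex_diff)

text \<open>Since \<open>2 * s * s' \<le> s\<^sup>2 + s'\<^sup>2\<close> and the squares of \<open>smooth_abs\<close> are polynomials, the tangent at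
  \<open>v\<close> bounds \<open>smooth_abs\<close> from above up to a quadratic term.  This uniform bound takes the place of
  differentiation under the integral sign.\<close>

lemma smooth_abs_quadratic_bound:
  assumes d: "0 < d"
  shows "smooth_abs d (v + k) \<le> smooth_abs d v + v / smooth_abs d v * k + k\<^sup>2 / (2 * d)"
proof -
  let ?s = "smooth_abs d v" and ?s' = "smooth_abs d (v + k)"
  have s: "0 < ?s" "d \<le> ?s" using smooth_abs_ge[OF d, of v] d by auto
  have "2 * ?s * ?s' \<le> ?s\<^sup>2 + ?s'\<^sup>2" by (rule sum_squares_bound)
  also have "\<dots> = 2 * ?s\<^sup>2 + 2 * v * k + k\<^sup>2"
    unfolding smooth_abs_sq by (simp add: power2_eq_square algebra_simps)
  finally have "?s' \<le> (2 * ?s\<^sup>2 + 2 * v * k + k\<^sup>2) / (2 * ?s)"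
    using s(1) by (simp add: pos_le_divide_eq mult.commute mult.left_commute)
  also have "\<dots> = ?s + v / ?s * k + k\<^sup>2 / (2 * ?s)"
    using s(1) by (simp add: power2_eq_square add_divide_distrib)
  also have "k\<^sup>2 / (2 * ?s) \<le> k\<^sup>2 / (2 * d)"
    using s d by (intro divide_left_mono) auto
  finally show ?thesis by simp
qed

lemma smooth_sign_gain:
  assumes d: "0 < d"
  shows "\<bar>v\<bar> - d \<le> v / smooth_abs d v * v"
proof -
  let ?s = "smooth_abs d v"
  have s: "0 < ?s" "d \<le> ?s" using smooth_abs_ge[OF d, of v] d by auto
  have "(\<bar>v\<bar> - d) * ?s \<le> ?s\<^sup>2 - d * ?s"
    using mult_right_mono[OF abs_le_smooth_abs[of v d], of ?s] s
    by (simp add: algebra_simps power2_eq_square)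
  also have "\<dots> \<le> ?s\<^sup>2 - d * d" using s d by simp
  also have "\<dots> = v * v" unfolding smooth_abs_sq by (simp add: power2_eq_square)
  finally show ?thesis using s(1) by (simp add: field_simps)
qed

lemma linear_le_quadratic_imp_zero:
  fixes G k :: real
  assumes "0 \<le> k" and le: "\<And>t. t * G \<le> t\<^sup>2 * k"
  shows "G = 0"
proof (rule ccontr)
  assume "G \<noteq> 0"
  then have G: "0 < G\<^sup>2" by simp
  have "G\<^sup>2 / (k + 1) * 1 \<le> G\<^sup>2 / (k + 1) * (k / (k + 1))"
    using le[of "G / (k + 1)"] by (simp add: power2_eq_square)
  moreover have "0 < G\<^sup>2 / (k + 1)" using G assms(1) by simp
  ultimately have "1 \<le> k / (k + 1)" by (simp only: mult_le_cancel_left_pos)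
  then show False using assms(1) by simp
qed

text \<open>The smoothed distance dominates \<open>\<integral> q * \<bar>\<Psi> - p\<bar>\<close>, so a polynomial \<open>p\<close> that does as well as
  \<open>0\<close> has weighted \<open>L\<^sup>1\<close> norm, and hence coefficients, bounded in terms of \<open>q\<close>, \<open>\<Psi>\<close> and \<open>d\<close>.\<close>

lemma smoothed_minimizer_exists:
  assumes q: "q \<in> bounded_borel" "\<And>x. 0 < q x" and \<Psi>: "\<Psi> \<in> bounded_borel"
  shows "\<exists>a. \<forall>b. circ_int (\<lambda>x. q x * smooth_abs d (\<Psi> x - cos_poly M a x))
               \<le> circ_int (\<lambda>x. q x * smooth_abs d (\<Psi> x - cos_poly M b x))"
proof -
  define J where "J a = circ_int (\<lambda>x. q x * smooth_abs d (\<Psi> x - cos_poly M a x))" for a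
  have sb: "(\<lambda>x. smooth_abs d (\<Psi> x - cos_poly M a x)) \<in> bounded_borel" for a
    unfolding smooth_abs_def by (intro bounded_borel_intros \<Psi>)
  obtain c where c: "0 < c" "\<And>a m. m \<le> M \<Longrightarrow> \<bar>a m\<bar> \<le> c * circ_int (\<lambda>x. q x * \<bar>cos_poly M a x\<bar>)"
    using weighted_coeff_bound[OF q] by blast
  have "\<exists>a. \<forall>b. J a \<le> J b"
  proof (rule coercive_attains_min)
    fix a b
    have "\<bar>J a - J b\<bar> = \<bar>circ_int (\<lambda>x. q x * smooth_abs d (\<Psi> x - cos_poly M a x)
        - q x * smooth_abs d (\<Psi> x - cos_poly M b x))\<bar>"
      unfolding J_def by (subst circ_int_diff) (intro bounded_borel_intros q sb | simp)+
    also have "\<dots> \<le> circ_int (\<lambda>x. \<bar>q x * smooth_abs d (\<Psi> x - cos_poly M a x)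
        - q x * smooth_abs d (\<Psi> x - cos_poly M b x)\<bar>)"
      by (rule circ_int_abs_le)
    also have "\<dots> \<le> circ_int (\<lambda>x. (\<Sum>m\<le>M. \<bar>a m - b m\<bar>) * q x)"
    proof (intro circ_int_mono)
      fix x
      have "\<bar>smooth_abs d (\<Psi> x - cos_poly M a x) - smooth_abs d (\<Psi> x - cos_poly M b x)\<bar>
          \<le> \<bar>(\<Psi> x - cos_poly M a x) - (\<Psi> x - cos_poly M b x)\<bar>"
        by (rule smooth_abs_lipschitz)
      also have "\<dots> = \<bar>\<Sum>m\<le>M. (b m - a m) * cos (real m * x)\<bar>"
        by (simp add: cos_poly_def left_diff_distrib sum_subtractf)
      also have "\<dots> \<le> (\<Sum>m\<le>M. \<bar>a m - b m\<bar>)"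
        by (rule order_trans[OF sum_abs])
          (auto intro!: sum_mono simp: abs_mult mult_left_le abs_minus_commute)
      finally show "\<bar>q x * smooth_abs d (\<Psi> x - cos_poly M a x)
          - q x * smooth_abs d (\<Psi> x - cos_poly M b x)\<bar> \<le> (\<Sum>m\<le>M. \<bar>a m - b m\<bar>) * q x"
        using q(2)[of x] unfolding right_diff_distrib[symmetric] abs_mult
        by (simp add: mult.commute)
    qed (intro bounded_borel_intros q sb)+
    finally show "\<bar>J a - J b\<bar> \<le> circ_int q * (\<Sum>m\<le>M. \<bar>a m - b m\<bar>)"
      unfolding circ_int_cmult by (simp only: mult.commute)
  next
    fix a m assume Ja: "J a \<le> J (\<lambda>_. 0)" and m: "m \<le> M"
    have "circ_int (\<lambda>x. q x * \<bar>cos_poly M a x\<bar>) \<le>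
        circ_int (\<lambda>x. q x * smooth_abs d (\<Psi> x - cos_poly M a x) + q x * \<bar>\<Psi> x\<bar>)"
    proof (intro circ_int_mono)
      fix x
      have "\<bar>cos_poly M a x\<bar> \<le> smooth_abs d (\<Psi> x - cos_poly M a x) + \<bar>\<Psi> x\<bar>"
        using abs_le_smooth_abs[of "\<Psi> x - cos_poly M a x" d] by linarith
      then show "q x * \<bar>cos_poly M a x\<bar> \<le> q x * smooth_abs d (\<Psi> x - cos_poly M a x) + q x * \<bar>\<Psi> x\<bar>"
        using q(2)[of x] by (simp flip: distrib_left)
    qed (intro bounded_borel_intros q sb \<Psi>)+
    also have "\<dots> = J a + circ_int (\<lambda>x. q x * \<bar>\<Psi> x\<bar>)"
      unfolding J_def by (intro circ_int_add bounded_borel_intros q sb \<Psi>)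
    also have "\<dots> \<le> J (\<lambda>_. 0) + circ_int (\<lambda>x. q x * \<bar>\<Psi> x\<bar>)" using Ja by simp
    finally have "c * circ_int (\<lambda>x. q x * \<bar>cos_poly M a x\<bar>)
        \<le> c * (J (\<lambda>_. 0) + circ_int (\<lambda>x. q x * \<bar>\<Psi> x\<bar>))"
      using c(1) by simp
    with c(2)[OF m, of a] show "\<bar>a m\<bar> \<le> c * (J (\<lambda>_. 0) + circ_int (\<lambda>x. q x * \<bar>\<Psi> x\<bar>))"
      by linarith
  qed
  then show ?thesis unfolding J_def .
qed

text \<open>The tangent vector is the derivative of \<open>smooth_abs d\<close> at \<open>\<Psi> - p\<close>, for \<open>p\<close> the cosine polynomial
  of best smoothed approximation: tangency is the stationarity of \<open>p\<close>.\<close>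

lemma near_extremal_tangent:
  assumes q: "q \<in> bounded_borel" "\<And>x. 0 < q x"
    and \<Psi>: "\<Psi> \<in> bounded_borel" "on_circle \<Psi>" "even_fun \<Psi>" and d: "0 < d"
  shows "\<exists>h\<in>tangent_ball q M 1. L1_defect q M \<Psi> - d * circ_int q \<le> circ_int (\<lambda>x. q x * h x * \<Psi> x)"
proof -
  obtain a where a: "\<And>b. circ_int (\<lambda>x. q x * smooth_abs d (\<Psi> x - cos_poly M a x))
      \<le> circ_int (\<lambda>x. q x * smooth_abs d (\<Psi> x - cos_poly M b x))"
    using smoothed_minimizer_exists[OF q \<Psi>(1)] by blast
  define w where "w x = \<Psi> x - cos_poly M a x" for x
  define h where "h x = w x / smooth_abs d (w x)" for x
  have wb: "w \<in> bounded_borel" unfolding w_def[abs_def] by (intro bounded_borel_intros \<Psi>)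
  have sb: "(\<lambda>x. smooth_abs d (w x)) \<in> bounded_borel"
    unfolding smooth_abs_def by (intro bounded_borel_intros wb)
  have spos: "0 < smooth_abs d v" for v using smooth_abs_ge[OF d, of v] d by linarith
  have h1: "\<bar>h x\<bar> \<le> 1" for x
    using abs_le_smooth_abs[of "w x" d] spos[of "w x"] by (simp add: h_def)
  have hb: "h \<in> bounded_borel"
  proof (rule bounded_borelI[OF _ h1])
    show "h \<in> borel_measurable borel"
      using wb sb unfolding h_def[abs_def] bounded_borel_def by (auto intro: borel_measurable_divide)
  qed
  have Q: "0 \<le> circ_int q" by (intro circ_int_nonneg less_imp_le q)
  have stationary: "circ_int (\<lambda>x. q x * h x * cos (real m * x)) = 0" if m: "m \<le> M" for m
  proof (rule linear_le_quadratic_imp_zero)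
    show "0 \<le> circ_int q / (2 * d)" using Q d by simp
    fix t :: real
    let ?I = "circ_int (\<lambda>x. q x * h x * cos (real m * x))"
    let ?J = "circ_int (\<lambda>x. q x * smooth_abs d (w x))"
    \<comment> \<open>Moving the minimiser along the \<open>m\<close>-th cosine cannot decrease the functional.\<close>
    define b where "b = a(m := a m + t)"
    have "cos_poly M b x = (\<Sum>k\<le>M. a k * cos (real k * x) + (if k = m then t * cos (real m * x) else 0))" for x
      unfolding cos_poly_def b_def by (intro sum.cong) (auto simp: algebra_simps)
    then have bx: "cos_poly M b x = cos_poly M a x + t * cos (real m * x)" for x
      using m by (simp add: sum.distrib cos_poly_def)
    have "?J \<le> circ_int (\<lambda>x. q x * smooth_abs d (\<Psi> x - cos_poly M b x))"
      using a[of b] by (simp add: w_def)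
    also have "\<dots> \<le> circ_int (\<lambda>x. q x * smooth_abs d (w x) - t * (q x * h x * cos (real m * x))
        + t\<^sup>2 / (2 * d) * q x)"
    proof (intro circ_int_mono)
      fix x
      have "smooth_abs d (\<Psi> x - cos_poly M b x) = smooth_abs d (w x + - t * cos (real m * x))"
        by (simp add: bx w_def diff_diff_eq)
      also have "\<dots> \<le> smooth_abs d (w x) + w x / smooth_abs d (w x) * (- t * cos (real m * x))
          + (- t * cos (real m * x))\<^sup>2 / (2 * d)"
        by (rule smooth_abs_quadratic_bound[OF d])
      also have "(- t * cos (real m * x))\<^sup>2 / (2 * d) \<le> t\<^sup>2 / (2 * d)"
        using d by (intro divide_right_mono)
          (auto simp: power_mult_distrib mult_left_le abs_square_le_1)
      finally have "q x * smooth_abs d (\<Psi> x - cos_poly M b x) \<le>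
          q x * (smooth_abs d (w x) + h x * (- t * cos (real m * x)) + t\<^sup>2 / (2 * d))"
        using q(2)[of x] by (simp add: h_def)
      then show "q x * smooth_abs d (\<Psi> x - cos_poly M b x) \<le>
          q x * smooth_abs d (w x) - t * (q x * h x * cos (real m * x)) + t\<^sup>2 / (2 * d) * q x"
        by (simp add: algebra_simps)
    next
      show "(\<lambda>x. q x * smooth_abs d (\<Psi> x - cos_poly M b x)) \<in> bounded_borel"
        unfolding smooth_abs_def by (intro bounded_borel_intros q \<Psi>)
    qed (intro bounded_borel_intros q sb hb)
    also have "\<dots> = ?J - t * ?I + t\<^sup>2 / (2 * d) * circ_int q"
      by (simp only: circ_int_add circ_int_diff circ_int_cmult bounded_borel_intros q sb hb)
    finally show "t * ?I \<le> t\<^sup>2 * (circ_int q / (2 * d))" by simp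
  qed
  have per: "cos_poly M a (x + 2 * pi) = cos_poly M a x" for x
  proof -
    have "cos (real m * (x + 2 * pi)) = cos (real m * x)" for m
      using cos_eq_periodic_intro[of "real m * (x + 2 * pi)" "real m * x" "int m"]
      by (simp add: algebra_simps)
    then show ?thesis by (simp add: cos_poly_def)
  qed
  have hT: "h \<in> tangent_space q M"
    using hb \<Psi>(2,3) stationary
    by (simp add: tangent_space_def bounded_borel_def on_circle_def even_fun_def h_def w_def per)
       (simp add: cos_poly_def)
  have "circ_int (\<lambda>x. q x * \<bar>w x\<bar>) - d * circ_int q = circ_int (\<lambda>x. q x * \<bar>w x\<bar> - d * q x)"
    by (simp only: circ_int_diff circ_int_cmult bounded_borel_intros q wb)
  also have "\<dots> \<le> circ_int (\<lambda>x. q x * h x * w x)"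
  proof (intro circ_int_mono)
    fix x
    have "q x * (\<bar>w x\<bar> - d) \<le> q x * (h x * w x)"
      unfolding h_def using less_imp_le[OF q(2)[of x]] by (intro mult_left_mono smooth_sign_gain d)
    then show "q x * \<bar>w x\<bar> - d * q x \<le> q x * h x * w x" by (simp add: algebra_simps)
  qed (intro bounded_borel_intros q wb hb)+
  also have "\<dots> = circ_int (\<lambda>x. q x * h x * \<Psi> x - q x * h x * cos_poly M a x)"
    by (simp add: w_def algebra_simps)
  also have "\<dots> = circ_int (\<lambda>x. q x * h x * \<Psi> x)"
    by (subst circ_int_diff) (intro bounded_borel_intros q \<Psi> hb | simp add: tangent_orthogonal[OF q(1) hT])+
  finally have "L1_defect q M \<Psi> - d * circ_int q \<le> circ_int (\<lambda>x. q x * h x * \<Psi> x)"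
    using L1_defect_le[of q M \<Psi> a] q(2) by (simp add: w_def less_imp_le)
  moreover have "h \<in> tangent_ball q M 1"
    using hT sup_norm_le[OF h1] by (simp add: tangent_ball_def)
  ultimately show ?thesis by blast
qed

section \<open>Constant predictors and the range of outputs\<close>

text \<open>A worst-case error of at most \<open>e\<close> at \<open>a\<close> confines the outputs to an interval of length \<open>2 * e\<close>.
  With \<open>e\<close> real this is an equivalence even if the output is unbounded on \<open>A\<close>.\<close>

lemma sup_abs_dev_le_iff:
  fixes R :: "'q \<Rightarrow> real"
  shows "(SUP q\<in>A. ereal \<bar>R q - a\<bar>) \<le> ereal e \<longleftrightarrow>
    (SUP q\<in>A. ereal (R q)) \<le> ereal (a + e) \<and> ereal (a - e) \<le> (INF q\<in>A. ereal (R q))"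
  unfolding SUP_le_iff le_INF_iff by (auto simp: abs_le_iff algebra_simps)

lemma half_range_le_constant_error:
  assumes "A \<noteq> {}"
  shows "ereal (1 / 2) * (sup_output R A - inf_output R A) \<le> (SUP q\<in>A. ereal \<bar>R q - a\<bar>)"
proof -
  obtain q where q: "q \<in> A" using assms by blast
  have "ereal 0 \<le> (SUP q\<in>A. ereal \<bar>R q - a\<bar>)" using q by (intro SUP_upper2[OF q]) simp
  then consider (real) e where "(SUP q\<in>A. ereal \<bar>R q - a\<bar>) = ereal e"
    | (inf) "(SUP q\<in>A. ereal \<bar>R q - a\<bar>) = \<infinity>"
    by (cases "SUP q\<in>A. ereal \<bar>R q - a\<bar>") auto
  then show ?thesis
  proof cases
    case real
    then have "sup_output R A \<le> ereal (a + e)" "ereal (a - e) \<le> inf_output R A"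
      using sup_abs_dev_le_iff[of R a A e] by (simp_all add: sup_output_def inf_output_def)
    moreover have "ereal (R q) \<le> sup_output R A" "inf_output R A \<le> ereal (R q)"
      unfolding sup_output_def inf_output_def using q by (auto intro: SUP_upper INF_lower)
    ultimately show ?thesis unfolding real
      by (cases "sup_output R A"; cases "inf_output R A") auto
  qed simp
qed

lemma midpoint_error:
  assumes "sup_output R A = ereal S" "inf_output R A = ereal I"
  shows "(SUP q\<in>A. ereal \<bar>R q - (I + S) / 2\<bar>) \<le> ereal ((S - I) / 2)"
  unfolding sup_abs_dev_le_iff using assms
  by (simp add: sup_output_def inf_output_def field_simps)

text \<open>If the range is infinite there is nothing to show for the upper bound, so the midpoint is needed
  only when both its ends are real.\<close>

lemma best_constant_error_eq:
  assumes "A \<noteq> {}"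
  shows "best_constant_error R A = ereal (1 / 2) * (sup_output R A - inf_output R A)"
proof (rule antisym)
  show "ereal (1 / 2) * (sup_output R A - inf_output R A) \<le> best_constant_error R A"
    unfolding best_constant_error_def
    by (intro INF_greatest half_range_le_constant_error assms)
  obtain q where q: "q \<in> A" using assms by blast
  have qb: "ereal (R q) \<le> sup_output R A" "inf_output R A \<le> ereal (R q)"
    unfolding sup_output_def inf_output_def using q by (auto intro: SUP_upper INF_lower)
  show "best_constant_error R A \<le> ereal (1 / 2) * (sup_output R A - inf_output R A)"
  proof (cases "sup_output R A - inf_output R A = \<infinity>")
    case False
    then obtain S I where SI: "sup_output R A = ereal S" "inf_output R A = ereal I"
      using qb by (cases "sup_output R A"; cases "inf_output R A") auto
    have "best_constant_error R A \<le> (SUP q\<in>A. ereal \<bar>R q - (I + S) / 2\<bar>)"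
      unfolding best_constant_error_def by (rule INF_lower) simp
    also have "\<dots> \<le> ereal ((S - I) / 2)" by (rule midpoint_error[OF SI])
    finally show ?thesis by (simp add: SI)
  qed simp
qed

lemma minimax_error_matched:
  assumes "A \<noteq> {}" and "\<forall>q\<in>A. \<forall>q'\<in>A. data q = data q'"
  shows "minimax_error R data A = best_constant_error R A"
proof -
  obtain q0 where q0: "q0 \<in> A" using assms(1) by blast
  have *: "worst_case_error R data A P = (SUP q\<in>A. ereal \<bar>R q - P (data q0)\<bar>)" for P
    unfolding worst_case_error_def using assms(2) q0 by (intro SUP_cong) metis+
  have "range (worst_case_error R data A) = range (\<lambda>a. SUP q\<in>A. ereal \<bar>R q - a\<bar>)"
  proof
    show "range (worst_case_error R data A) \<subseteq> range (\<lambda>a. SUP q\<in>A. ereal \<bar>R q - a\<bar>)"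
      unfolding * by auto
    show "range (\<lambda>a. SUP q\<in>A. ereal \<bar>R q - a\<bar>) \<subseteq> range (worst_case_error R data A)"
    proof
      fix y assume "y \<in> range (\<lambda>a. SUP q\<in>A. ereal \<bar>R q - a\<bar>)"
      then obtain a where "y = worst_case_error R data A (\<lambda>_. a)"
        by (auto simp: worst_case_error_def)
      then show "y \<in> range (worst_case_error R data A)" by blast
    qed
  qed
  then show ?thesis unfolding minimax_error_def best_constant_error_def by simp
qed

section \<open>Outputs on the perturbation class\<close>

lemma tangent_space_scale:
  assumes "u \<in> tangent_space q M" shows "(\<lambda>x. c * u x) \<in> tangent_space q M"
proof -
  have "(\<lambda>x. c * u x) \<in> bounded_borel"
    by (intro bounded_borel_intros tangent_space_bounded_borel[OF assms])
  moreover have "circ_int (\<lambda>x. q x * (c * u x) * cos (real m * x)) =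
      c * circ_int (\<lambda>x. q x * u x * cos (real m * x))" for m
    unfolding circ_int_cmult[symmetric] by (simp add: mult_ac)
  ultimately show ?thesis using assms
    by (simp add: tangent_space_def bounded_borel_def on_circle_def even_fun_def)
qed

lemma tangent_space_bounded: "u \<in> tangent_space q M \<Longrightarrow> bounded (range u)"
  by (simp add: tangent_space_def)

lemma tangent_ball_scale:
  assumes "h \<in> tangent_ball q M \<epsilon>" and "\<bar>t\<bar> * \<epsilon> \<le> \<delta>"
  shows "(\<lambda>x. t * h x) \<in> tangent_ball q M \<delta>"
proof -
  have h: "h \<in> tangent_space q M" "sup_norm h \<le> \<epsilon>"
    using assms(1) by (auto simp: tangent_ball_def)
  have "\<bar>t\<bar> * sup_norm h \<le> \<bar>t\<bar> * \<epsilon>" using h(2) by (intro mult_left_mono) auto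
  then show ?thesis using assms(2) h
    by (simp add: tangent_ball_def tangent_space_scale sup_norm_scale tangent_space_bounded)
qed

lemma zero_in_tangent_ball: "0 \<le> \<epsilon> \<Longrightarrow> (\<lambda>x. 0) \<in> tangent_ball q M \<epsilon>"
  by (simp add: tangent_ball_def tangent_space_def on_circle_def even_fun_def sup_norm_def
      circ_int_def set_lebesgue_integral_def)

lemma matched_rates_perturbed:
  assumes q: "q \<in> bounded_borel" and h: "h \<in> tangent_ball q M \<epsilon>"
  shows "matched_rates \<alpha> M (perturbed q h) = matched_rates \<alpha> M q"
proof -
  have hT: "h \<in> tangent_space q M" using h by (simp add: tangent_ball_def)
  have "circ_int (\<lambda>x. perturbed q h x * cos (real m * x)) = circ_int (\<lambda>x. q x * cos (real m * x))"
    if m: "m \<le> M" for m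
  proof -
    have "circ_int (\<lambda>x. perturbed q h x * cos (real m * x)) =
        circ_int (\<lambda>x. q x * cos (real m * x) + q x * h x * cos (real m * x))"
      by (simp add: perturbed_def algebra_simps)
    also have "\<dots> = circ_int (\<lambda>x. q x * cos (real m * x)) + circ_int (\<lambda>x. q x * h x * cos (real m * x))"
      by (intro circ_int_add bounded_borel_intros q tangent_space_bounded_borel[OF hT])
    finally show ?thesis using hT m by (simp add: tangent_space_def)
  qed
  then show ?thesis by (auto simp: matched_rates_def turning_rate_def less_Suc_eq_le)
qed

text \<open>The form in which the linearisation is used: \<open>\<rho>\<close> is the supremum of the linear part, approached
  but possibly not attained, and \<open>r\<close> bounds the remainder.\<close>

lemma output_range_bounds:
  fixes R :: "(real \<Rightarrow> real) \<Rightarrow> real"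
  assumes ne: "A \<noteq> {}"
    and near: "\<And>q. q \<in> A \<Longrightarrow> R0 - \<rho> - r \<le> R q \<and> R q \<le> R0 + \<rho> + r"
    and top: "\<And>e. 0 < e \<Longrightarrow> \<exists>q\<in>A. R0 + \<rho> - r - e \<le> R q"
    and bot: "\<And>e. 0 < e \<Longrightarrow> \<exists>q\<in>A. R q \<le> R0 - \<rho> + r + e"
  shows "\<exists>S I. sup_output R A = ereal S \<and> inf_output R A = ereal I \<and>
    \<bar>S - (R0 + \<rho>)\<bar> \<le> r \<and> \<bar>I - (R0 - \<rho>)\<bar> \<le> r"
proof -
  have bdd: "bdd_above (R ` A)" "bdd_below (R ` A)"
    using near by (fastforce intro: bdd_aboveI bdd_belowI)+
  define S where "S = (SUP q\<in>A. R q)"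
  define I where "I = (INF q\<in>A. R q)"
  obtain q where q: "q \<in> A" using ne by blast
  have "ereal (R q) \<le> (SUP q\<in>A. ereal (R q))" "(SUP q\<in>A. ereal (R q)) \<le> ereal (R0 + \<rho> + r)"
    "(INF q\<in>A. ereal (R q)) \<le> ereal (R q)" "ereal (R0 - \<rho> - r) \<le> (INF q\<in>A. ereal (R q))"
    using q near by (auto intro!: SUP_upper INF_lower SUP_least INF_greatest)
  then have bounded: "\<bar>SUP q\<in>A. ereal (R q)\<bar> \<noteq> \<infinity>" "\<bar>INF q\<in>A. ereal (R q)\<bar> \<noteq> \<infinity>"
    by auto
  have SI: "sup_output R A = ereal S" "inf_output R A = ereal I"
    unfolding sup_output_def inf_output_def S_def I_def
    using bounded
    by (auto intro!: ereal_SUP[symmetric] ereal_INF[symmetric])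
  have "S \<le> R0 + \<rho> + r" unfolding S_def using ne near by (intro cSUP_least) auto
  moreover have "R0 - \<rho> - r \<le> I" unfolding I_def using ne near by (intro cINF_greatest) auto
  moreover have "R0 + \<rho> - r \<le> S"
  proof (rule field_le_epsilon)
    fix e :: real assume "0 < e"
    then obtain q where "q \<in> A" "R0 + \<rho> - r - e \<le> R q" using top by blast
    moreover from \<open>q \<in> A\<close> have "R q \<le> S" unfolding S_def by (rule cSUP_upper[OF _ bdd(1)])
    ultimately show "R0 + \<rho> - r \<le> S + e" by linarith
  qed
  moreover have "I \<le> R0 - \<rho> + r"
  proof (rule field_le_epsilon)
    fix e :: real assume "0 < e"
    then obtain q where "q \<in> A" "R q \<le> R0 - \<rho> + r + e" using bot by blast
    moreover from \<open>q \<in> A\<close> have "I \<le> R q" unfolding I_def by (rule cINF_lower[OF bdd(2)])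
    ultimately show "I \<le> R0 - \<rho> + r + e" by linarith
  qed
  ultimately show ?thesis using SI by (auto simp: abs_le_iff)
qed

lemma kernel_class_range:
  fixes R :: "(real \<Rightarrow> real) \<Rightarrow> real"
  assumes q: "base_kernel q0"
    and \<Psi>: "on_circle \<Psi>" "bounded (range \<Psi>)" "even_fun \<Psi>"
    and \<epsilon>: "0 < \<epsilon>"
    and taylor: "\<And>h. h \<in> tangent_ball q0 M \<epsilon> \<Longrightarrow>
      \<bar>R (perturbed q0 h) - R q0 - circ_int (\<lambda>x. q0 x * h x * \<Psi> x)\<bar> \<le> r"
  shows "\<exists>S I. sup_output R (kernel_class q0 M \<epsilon>) = ereal S \<and>
    inf_output R (kernel_class q0 M \<epsilon>) = ereal I \<and>
    \<bar>S - (R q0 + \<epsilon> * L1_defect q0 M \<Psi>)\<bar> \<le> r \<and> \<bar>I - (R q0 - \<epsilon> * L1_defect q0 M \<Psi>)\<bar> \<le> r"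
proof -
  let ?D = "L1_defect q0 M \<Psi>" and ?l = "\<lambda>h. circ_int (\<lambda>x. q0 x * h x * \<Psi> x)"
  have qb: "q0 \<in> bounded_borel" and qpos: "\<And>x. 0 < q0 x" and q1: "circ_int q0 = 1"
    using q by (auto simp: base_kernel_def turning_kernel_def on_circle_def bounded_borel_def)
  have \<Psi>b: "\<Psi> \<in> bounded_borel" using \<Psi> by (simp add: on_circle_def bounded_borel_def)
  have l_scale: "?l (\<lambda>x. t * h x) = t * ?l h" for t h
    unfolding circ_int_cmult[symmetric] by (simp add: mult_ac)
  have neg: "(\<lambda>x. - 1 * h x) \<in> tangent_ball q0 M \<epsilon>" if "h \<in> tangent_ball q0 M \<epsilon>" for h
    by (rule tangent_ball_scale[OF that]) simp
  have l_le: "?l h \<le> \<epsilon> * ?D" if "h \<in> tangent_ball q0 M \<epsilon>" for h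
    by (rule weak_duality[OF qb less_imp_le[OF qpos] \<Psi>b that \<epsilon>])
  have l_ge: "- (\<epsilon> * ?D) \<le> ?l h" if "h \<in> tangent_ball q0 M \<epsilon>" for h
    using l_le[OF neg[OF that]] unfolding l_scale by simp
  have attain: "\<exists>h\<in>tangent_ball q0 M \<epsilon>. \<epsilon> * ?D - e \<le> ?l h" if e: "0 < e" for e
  proof -
    obtain h where h: "h \<in> tangent_ball q0 M 1" "?D - e / \<epsilon> \<le> ?l h"
      using near_extremal_tangent[OF qb qpos \<Psi>b \<Psi>(1,3), of "e / \<epsilon>" M] e \<epsilon> q1 by auto
    have "(\<lambda>x. \<epsilon> * h x) \<in> tangent_ball q0 M \<epsilon>"
      using \<epsilon> by (intro tangent_ball_scale[OF h(1)]) simp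
    moreover have "\<epsilon> * ?D - e \<le> ?l (\<lambda>x. \<epsilon> * h x)"
      unfolding l_scale using mult_left_mono[OF h(2), of \<epsilon>] \<epsilon> by (simp add: right_diff_distrib)
    ultimately show ?thesis by (intro bexI[of _ "\<lambda>x. \<epsilon> * h x"])
  qed
  show ?thesis
  proof (rule output_range_bounds)
    show "kernel_class q0 M \<epsilon> \<noteq> {}"
      using zero_in_tangent_ball[of \<epsilon>] \<epsilon> by (auto simp: kernel_class_def)
  next
    fix p assume "p \<in> kernel_class q0 M \<epsilon>"
    then obtain h where "h \<in> tangent_ball q0 M \<epsilon>" "p = perturbed q0 h"
      by (auto simp: kernel_class_def)
    then show "R q0 - \<epsilon> * ?D - r \<le> R p \<and> R p \<le> R q0 + \<epsilon> * ?D + r"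
      using taylor[of h] l_le[of h] l_ge[of h] by (auto simp: abs_le_iff)
  next
    fix e :: real assume "0 < e"
    then obtain h where h: "h \<in> tangent_ball q0 M \<epsilon>" "\<epsilon> * ?D - e \<le> ?l h"
      using attain by blast
    have "R q0 + \<epsilon> * ?D - r - e \<le> R (perturbed q0 h)"
      using taylor[OF h(1)] h(2) by (auto simp: abs_le_iff)
    then show "\<exists>p\<in>kernel_class q0 M \<epsilon>. R q0 + \<epsilon> * ?D - r - e \<le> R p"
      using h(1) by (auto simp: kernel_class_def)
    have "R (perturbed q0 (\<lambda>x. - 1 * h x)) \<le> R q0 - \<epsilon> * ?D + r + e"
      using taylor[OF neg[OF h(1)]] h(2) unfolding l_scale by (auto simp: abs_le_iff)
    then show "\<exists>p\<in>kernel_class q0 M \<epsilon>. R p \<le> R q0 - \<epsilon> * ?D + r + e"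
      using neg[OF h(1)] by (auto simp: kernel_class_def)
  qed
qed

lemma range_and_half_range_error:
  fixes S I c \<rho> r :: real
  assumes "\<bar>S - (c + \<rho>)\<bar> \<le> r" "\<bar>I - (c - \<rho>)\<bar> \<le> r"
  shows "\<bar>S - I - 2 * \<rho>\<bar> \<le> 2 * r" "\<bar>(S - I) / 2 - \<rho>\<bar> \<le> r"
proof -
  have "\<bar>(S - (c + \<rho>)) - (I - (c - \<rho>))\<bar> \<le> r + r"
    by (rule order_trans[OF abs_triangle_ineq4 add_mono[OF assms]])
  then show "\<bar>S - I - 2 * \<rho>\<bar> \<le> 2 * r" by simp
  moreover have "(S - I) / 2 - \<rho> = (S - I - 2 * \<rho>) / 2" by (simp add: field_simps)
  then have "\<bar>(S - I) / 2 - \<rho>\<bar> = \<bar>S - I - 2 * \<rho>\<bar> / 2"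
    by (simp only: abs_divide abs_numeral)
  ultimately show "\<bar>(S - I) / 2 - \<rho>\<bar> \<le> r"
    by (metis divide_right_mono nonzero_mult_div_cancel_left zero_le_numeral zero_neq_numeral)
qed

theorem propositionS11:
  fixes R :: "(real \<Rightarrow> real) \<Rightarrow> real"
    and data :: "(real \<Rightarrow> real) \<Rightarrow> 'd"
    and \<A> :: "(real \<Rightarrow> real) set"
    and q0 \<Psi> :: "real \<Rightarrow> real"
    and M :: nat
    and \<alpha> \<epsilon>0 H :: real
    and DR :: "(real \<Rightarrow> real) \<Rightarrow> (real \<Rightarrow> real) \<Rightarrow> real"
    and D2R :: "(real \<Rightarrow> real) \<Rightarrow> (real \<Rightarrow> real) \<Rightarrow> (real \<Rightarrow> real) \<Rightarrow> real"
  shows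
   "(\<A> \<noteq> {} \<and> (\<forall>q\<in>\<A>. turning_kernel q) \<and> (\<forall>q\<in>\<A>. \<forall>q'\<in>\<A>. data q = data q') \<longrightarrow>
       (\<forall>P :: 'd \<Rightarrow> real. \<exists>a. \<forall>q\<in>\<A>. P (data q) = a) \<and>
       minimax_error R data \<A> = best_constant_error R \<A> \<and>
       best_constant_error R \<A> = ereal (1 / 2) * (sup_output R \<A> - inf_output R \<A>))
    \<and>
    (base_kernel q0 \<and> 0 < \<alpha> \<and>
     on_circle \<Psi> \<and> bounded (range \<Psi>) \<and> continuous_on UNIV \<Psi> \<and> even_fun \<Psi> \<and>
     0 < \<epsilon>0 \<and> \<epsilon>0 < 1 \<and>
     C2_on (tangent_space q0 M) (tangent_ball q0 M \<epsilon>0) (\<lambda>h. R (perturbed q0 h)) DR D2R \<and>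
     (\<forall>h\<in>tangent_ball q0 M \<epsilon>0. bilinear_norm_on (tangent_space q0 M) (D2R h) \<le> H) \<and>
     (\<forall>h\<in>tangent_space q0 M. DR (\<lambda>x. 0) h = circ_int (\<lambda>x. q0 x * h x * \<Psi> x))
     \<longrightarrow>
       (\<forall>\<epsilon>. 0 < \<epsilon> \<and> \<epsilon> \<le> \<epsilon>0 \<longrightarrow>
         (let A = kernel_class q0 M \<epsilon>; D = L1_defect q0 M \<Psi>; r = 1 / 2 * H * \<epsilon>\<^sup>2 in
           \<bar>sup_output R A - ereal (R q0 + \<epsilon> * D)\<bar> \<le> ereal r \<and>
           \<bar>inf_output R A - ereal (R q0 - \<epsilon> * D)\<bar> \<le> ereal r \<and>
           \<bar>sup_output R A - inf_output R A - ereal (2 * \<epsilon> * D)\<bar> \<le> ereal (H * \<epsilon>\<^sup>2) \<and>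
           \<bar>minimax_error R (matched_rates \<alpha> M) A - ereal (\<epsilon> * D)\<bar> \<le> ereal r \<and>
           (\<exists>c. ereal c = (inf_output R A + sup_output R A) / 2 \<and>
                worst_case_error R (matched_rates \<alpha> M) A (\<lambda>_. c)
                  = minimax_error R (matched_rates \<alpha> M) A))) \<and>
       (\<lambda>\<epsilon>. real_of_ereal (sup_output R (kernel_class q0 M \<epsilon>) - inf_output R (kernel_class q0 M \<epsilon>))
             - 2 * \<epsilon> * L1_defect q0 M \<Psi>) \<in> O[at_right 0](\<lambda>\<epsilon>. \<epsilon>\<^sup>2) \<and>
       (\<lambda>\<epsilon>. real_of_ereal (minimax_error R (matched_rates \<alpha> M) (kernel_class q0 M \<epsilon>))
             - \<epsilon> * L1_defect q0 M \<Psi>) \<in> O[at_right 0](\<lambda>\<epsilon>. \<epsilon>\<^sup>2))"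
    (is "(?hypA \<longrightarrow> ?conclA) \<and> (?hypB \<longrightarrow> ?conclB)")
proof (intro conjI[of "?hypA \<longrightarrow> ?conclA"] impI)
  assume A: ?hypA
  then have ne: "\<A> \<noteq> {}" and same: "\<forall>q\<in>\<A>. \<forall>q'\<in>\<A>. data q = data q'" by blast+
  show ?conclA
  proof (intro conjI allI)
    fix P :: "'d \<Rightarrow> real"
    show "\<exists>a. \<forall>q\<in>\<A>. P (data q) = a" using same by metis
  qed (rule minimax_error_matched[OF ne same] best_constant_error_eq[OF ne])+
next
  assume B: ?hypB
  let ?D = "L1_defect q0 M \<Psi>" and ?A = "kernel_class q0 M" and ?rates = "matched_rates \<alpha> M"
  from B have q0: "base_kernel q0" and \<epsilon>0: "0 < \<epsilon>0"
    and \<Psi>: "on_circle \<Psi>" "bounded (range \<Psi>)" "even_fun \<Psi>"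
    and C2: "C2_on (tangent_space q0 M) (tangent_ball q0 M \<epsilon>0) (\<lambda>h. R (perturbed q0 h)) DR D2R"
    and H: "\<And>h. h \<in> tangent_ball q0 M \<epsilon>0 \<Longrightarrow> bilinear_norm_on (tangent_space q0 M) (D2R h) \<le> H"
    and DR: "\<And>h. h \<in> tangent_space q0 M \<Longrightarrow> DR (\<lambda>x. 0) h = circ_int (\<lambda>x. q0 x * h x * \<Psi> x)"
    by blast+
  have qb: "q0 \<in> bounded_borel"
    using q0 by (simp add: base_kernel_def turning_kernel_def on_circle_def bounded_borel_def)
  \<comment> \<open>The remainder is first bounded with \<open>sup_norm h\<close>; monotonicity in it requires \<open>H\<close> to be nonnegative.\<close>
  have H0: "0 \<le> H"
  proof -
    have z: "(\<lambda>x. 0) \<in> tangent_ball q0 M \<epsilon>" if "0 < \<epsilon>" for \<epsilon>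
      using that by (intro zero_in_tangent_ball) simp
    have "(\<lambda>x. 0) \<in> tangent_ball q0 M \<epsilon>0" using \<epsilon>0 by (rule z)
    then have B0: "bounded_bilinear_form_on (tangent_space q0 M) (D2R (\<lambda>x. 0))"
      and le: "bilinear_norm_on (tangent_space q0 M) (D2R (\<lambda>x. 0)) \<le> H"
      using C2 H by (simp_all add: C2_on_def)
    have "(\<lambda>x. 0) \<in> tangent_space q0 M" "sup_norm (\<lambda>x. 0) \<le> 1"
      using z[of 1] by (simp_all add: tangent_ball_def)
    then have "\<bar>D2R (\<lambda>x. 0) (\<lambda>x. 0) (\<lambda>x. 0)\<bar> \<le> bilinear_norm_on (tangent_space q0 M) (D2R (\<lambda>x. 0))"
      by (intro abs_le_bilinear_norm[OF tangent_space_bounded B0])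
    with le show ?thesis by linarith
  qed
  have taylor: "\<bar>R (perturbed q0 h) - R q0 - circ_int (\<lambda>x. q0 x * h x * \<Psi> x)\<bar> \<le> 1 / 2 * H * \<epsilon>\<^sup>2"
    if \<epsilon>: "0 < \<epsilon>" "\<epsilon> \<le> \<epsilon>0" and h: "h \<in> tangent_ball q0 M \<epsilon>" for \<epsilon> h
  proof -
    have hT: "h \<in> tangent_space q0 M" and hn: "sup_norm h \<le> \<epsilon>"
      using h by (auto simp: tangent_ball_def)
    have seg: "(\<lambda>x. t * h x) \<in> tangent_ball q0 M \<epsilon>0" if "0 \<le> t" "t \<le> 1" for t
    proof (rule tangent_ball_scale[OF h])
      have "t * \<epsilon> \<le> 1 * \<epsilon>" using that \<epsilon> by (intro mult_right_mono) auto
      then show "\<bar>t\<bar> * \<epsilon> \<le> \<epsilon>0" using that \<epsilon> by (simp only: abs_of_nonneg)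
    qed
    have "\<bar>R (perturbed q0 h) - R (perturbed q0 (\<lambda>x. 0)) - DR (\<lambda>x. 0) h\<bar> \<le> H / 2 * (sup_norm h)\<^sup>2"
      by (rule C2_second_order_remainder[OF tangent_space_scale tangent_space_bounded C2 H hT seg])
    also have "\<dots> \<le> H / 2 * \<epsilon>\<^sup>2"
      using H0 hn sup_norm_nonneg[OF tangent_space_bounded[OF hT]]
      by (intro mult_left_mono power_mono) auto
    finally show ?thesis by (simp add: perturbed_def DR[OF hT])
  qed
  have main: "\<exists>S I. sup_output R (?A \<epsilon>) = ereal S \<and> inf_output R (?A \<epsilon>) = ereal I \<and>
      minimax_error R ?rates (?A \<epsilon>) = ereal ((S - I) / 2) \<and>
      worst_case_error R ?rates (?A \<epsilon>) (\<lambda>_. (I + S) / 2) = ereal ((S - I) / 2) \<and>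
      \<bar>S - (R q0 + \<epsilon> * ?D)\<bar> \<le> 1 / 2 * H * \<epsilon>\<^sup>2 \<and> \<bar>I - (R q0 - \<epsilon> * ?D)\<bar> \<le> 1 / 2 * H * \<epsilon>\<^sup>2"
    if \<epsilon>: "0 < \<epsilon>" "\<epsilon> \<le> \<epsilon>0" for \<epsilon>
  proof -
    obtain S I where SI: "sup_output R (?A \<epsilon>) = ereal S" "inf_output R (?A \<epsilon>) = ereal I"
      and bounds: "\<bar>S - (R q0 + \<epsilon> * ?D)\<bar> \<le> 1 / 2 * H * \<epsilon>\<^sup>2" "\<bar>I - (R q0 - \<epsilon> * ?D)\<bar> \<le> 1 / 2 * H * \<epsilon>\<^sup>2"
      using kernel_class_range[OF q0 \<Psi> \<epsilon>(1) taylor[OF \<epsilon>]] by blast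
    have ne: "?A \<epsilon> \<noteq> {}"
      using zero_in_tangent_ball[of \<epsilon>] \<epsilon> by (auto simp: kernel_class_def)
    have same: "\<forall>q\<in>?A \<epsilon>. \<forall>q'\<in>?A \<epsilon>. ?rates q = ?rates q'"
      by (auto simp: kernel_class_def matched_rates_perturbed[OF qb])
    have mm: "minimax_error R ?rates (?A \<epsilon>) = ereal ((S - I) / 2)"
      using minimax_error_matched[OF ne same] best_constant_error_eq[OF ne, of R] SI by simp
    have "worst_case_error R ?rates (?A \<epsilon>) (\<lambda>_. (I + S) / 2) = ereal ((S - I) / 2)"
    proof (rule antisym)
      show "worst_case_error R ?rates (?A \<epsilon>) (\<lambda>_. (I + S) / 2) \<le> ereal ((S - I) / 2)"
        unfolding worst_case_error_def by (rule midpoint_error[OF SI])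
      show "ereal ((S - I) / 2) \<le> worst_case_error R ?rates (?A \<epsilon>) (\<lambda>_. (I + S) / 2)"
        unfolding mm[symmetric] minimax_error_def by (rule INF_lower) simp
    qed
    with SI mm bounds show ?thesis by blast
  qed
  have small: "\<forall>\<^sub>F \<epsilon> in at_right 0. 0 < \<epsilon> \<and> \<epsilon> \<le> \<epsilon>0"
    using \<epsilon>0 by (auto simp: eventually_at_right_field intro!: exI[of _ \<epsilon>0])
  show ?conclB
  proof (intro conjI allI impI)
    fix \<epsilon> assume "0 < \<epsilon> \<and> \<epsilon> \<le> \<epsilon>0"
    then obtain S I where *: "sup_output R (?A \<epsilon>) = ereal S" "inf_output R (?A \<epsilon>) = ereal I"
      "minimax_error R ?rates (?A \<epsilon>) = ereal ((S - I) / 2)"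
      "worst_case_error R ?rates (?A \<epsilon>) (\<lambda>_. (I + S) / 2) = ereal ((S - I) / 2)"
      "\<bar>S - (R q0 + \<epsilon> * ?D)\<bar> \<le> 1 / 2 * H * \<epsilon>\<^sup>2" "\<bar>I - (R q0 - \<epsilon> * ?D)\<bar> \<le> 1 / 2 * H * \<epsilon>\<^sup>2"
      using main by blast
    have "\<bar>S - I - 2 * \<epsilon> * ?D\<bar> \<le> H * \<epsilon>\<^sup>2" "\<bar>(S - I) / 2 - \<epsilon> * ?D\<bar> \<le> 1 / 2 * H * \<epsilon>\<^sup>2"
      using range_and_half_range_error[OF *(5,6)] by simp_all
    moreover have "ereal ((I + S) / 2) = (ereal I + ereal S) / 2"
      by (simp add: numeral_eq_ereal)
    ultimately show "let A = ?A \<epsilon>; D = ?D; r = 1 / 2 * H * \<epsilon>\<^sup>2 in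
           \<bar>sup_output R A - ereal (R q0 + \<epsilon> * D)\<bar> \<le> ereal r \<and>
           \<bar>inf_output R A - ereal (R q0 - \<epsilon> * D)\<bar> \<le> ereal r \<and>
           \<bar>sup_output R A - inf_output R A - ereal (2 * \<epsilon> * D)\<bar> \<le> ereal (H * \<epsilon>\<^sup>2) \<and>
           \<bar>minimax_error R ?rates A - ereal (\<epsilon> * D)\<bar> \<le> ereal r \<and>
           (\<exists>c. ereal c = (inf_output R A + sup_output R A) / 2 \<and>
                worst_case_error R ?rates A (\<lambda>_. c) = minimax_error R ?rates A)"
      using *(4,5,6) unfolding Let_def *(1-3) by (auto intro!: exI[of _ "(I + S) / 2"])
  next
    show "(\<lambda>\<epsilon>. real_of_ereal (sup_output R (?A \<epsilon>) - inf_output R (?A \<epsilon>)) - 2 * \<epsilon> * ?D)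
        \<in> O[at_right 0](\<lambda>\<epsilon>. \<epsilon>\<^sup>2)"
    proof (rule bigoI[where c=H], rule eventually_mono[OF small])
      fix \<epsilon> assume "0 < \<epsilon> \<and> \<epsilon> \<le> \<epsilon>0"
      then obtain S I where *: "sup_output R (?A \<epsilon>) = ereal S" "inf_output R (?A \<epsilon>) = ereal I"
        "\<bar>S - (R q0 + \<epsilon> * ?D)\<bar> \<le> 1 / 2 * H * \<epsilon>\<^sup>2" "\<bar>I - (R q0 - \<epsilon> * ?D)\<bar> \<le> 1 / 2 * H * \<epsilon>\<^sup>2"
        using main by blast
      have "\<bar>S - I - 2 * \<epsilon> * ?D\<bar> \<le> H * \<epsilon>\<^sup>2" using range_and_half_range_error[OF *(3,4)] by simp
      then show "norm (real_of_ereal (sup_output R (?A \<epsilon>) - inf_output R (?A \<epsilon>)) - 2 * \<epsilon> * ?D)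
          \<le> H * norm (\<epsilon>\<^sup>2)"
        by (simp add: *)
    qed
    show "(\<lambda>\<epsilon>. real_of_ereal (minimax_error R ?rates (?A \<epsilon>)) - \<epsilon> * ?D) \<in> O[at_right 0](\<lambda>\<epsilon>. \<epsilon>\<^sup>2)"
    proof (rule bigoI[where c="1 / 2 * H"], rule eventually_mono[OF small])
      fix \<epsilon> assume "0 < \<epsilon> \<and> \<epsilon> \<le> \<epsilon>0"
      then obtain S I where *: "minimax_error R ?rates (?A \<epsilon>) = ereal ((S - I) / 2)"
        "\<bar>S - (R q0 + \<epsilon> * ?D)\<bar> \<le> 1 / 2 * H * \<epsilon>\<^sup>2" "\<bar>I - (R q0 - \<epsilon> * ?D)\<bar> \<le> 1 / 2 * H * \<epsilon>\<^sup>2"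
        using main by blast
      have "\<bar>(S - I) / 2 - \<epsilon> * ?D\<bar> \<le> 1 / 2 * H * \<epsilon>\<^sup>2" using range_and_half_range_error[OF *(2,3)] by simp
      then show "norm (real_of_ereal (minimax_error R ?rates (?A \<epsilon>)) - \<epsilon> * ?D)
          \<le> 1 / 2 * H * norm (\<epsilon>\<^sup>2)"
        by (simp add: *)
    qed
  qed
qed

end
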